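(* Let $K$ be a number field with ring of integers $\mathcal{O}_K$, and let $\mathcal{R}_K$ be a chosen unique factorization domain with $\mathcal{O}_K\subset\mathcal{R}_K\subset K$ whose group of units is finitely generated (if $K$ has class number one, $\mathcal{R}_K=\mathcal{O}_K$). Let $e_1,e_2,e_3\in\mathcal{R}_K[t]$ and let $E=E(t):y^2=(x-e_1)(x-e_2)(x-e_3)$ be a nonconstant elliptic curve over $K(t)$. Let $t_0\in K$ satisfy the following condition (C): for every nonconstant square-free divisor $h$ in $\mathcal{R}_K[t]$ of $(e_1-e_2)(e_1-e_3)$, or of $(e_2-e_1)(e_2-e_3)$, or of $(e_3-e_1)(e_3-e_2)$, the algebraic number $h(t_0)$ is not a square in $K$. Then the specialization homomorphism $\sigma_{t_0}:E(K(t))\to E(t_0)(K)$ is injective.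
   Context: An elliptic curve over $K(t)$ is called nonconstant if it is not isomorphic over $K(t)$ to an elliptic curve defined over $K$. For $t_0\in K$, $E(t_0)$ denotes the curve over $K$ obtained by substituting $t=t_0$ in the coefficients; when it is nonsingular, the specialization homomorphism $\sigma_{t_0}:E(K(t))\to E(t_0)(K)$ sends a point to the point obtained by substituting $t=t_0$ (points reducing to infinity go to the neutral element $O$). *)

theory Defs
  imports
    "HOL-Algebra.Ring_Divisibility"
    "HOL-Algebra.Generated_Groups"
    "HOL-Computational_Algebra.Polynomial_Factorial"
begin

section \<open>Number fields and their subrings\<close>

definition number_field :: "'k::field_char_0 itself \<Rightarrow> bool" where
  "number_field _ \<longleftrightarrow>
     (\<exists>B. finite_dimensional_vector_space (\<lambda>(q::rat) (x::'k). of_rat q * x) B)"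

definition ring_of_integers :: "'k::field_char_0 set" where
  "ring_of_integers = {x. algebraic_int x}"

definition ring_on :: "'a::comm_ring_1 set \<Rightarrow> 'a ring" where
  "ring_on S = \<lparr>carrier = S, monoid.mult = (*), one = 1, zero = 0, add = (+)\<rparr>"

text \<open>Every ideal class of a number field is represented by an integral ideal, so it suffices
  to consider nonzero integral ideals, with \<open>I \<sim> J\<close> iff \<open>a I = b J\<close> for some nonzero
  integers \<open>a, b\<close>.\<close>

definition nonzero_ideals :: "'k::field_char_0 set set" where
  "nonzero_ideals = {I. ideal I (ring_on ring_of_integers) \<and> I \<noteq> {0}}"

definition ideal_class_rel :: "('k::field_char_0 set \<times> 'k set) set" where
  "ideal_class_rel = {(I, J). I \<in> nonzero_ideals \<and> J \<in> nonzero_ideals \<and>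
     (\<exists>a\<in>ring_of_integers. \<exists>b\<in>ring_of_integers. a \<noteq> 0 \<and> b \<noteq> 0 \<and> (*) a ` I = (*) b ` J)}"

definition class_number :: "'k::field_char_0 itself \<Rightarrow> nat" where
  "class_number _ = card ((nonzero_ideals :: 'k set set) // ideal_class_rel)"

definition finitely_generated_units :: "('a, 'b) ring_scheme \<Rightarrow> bool" where
  "finitely_generated_units R \<longleftrightarrow>
     (\<exists>S. finite S \<and> S \<subseteq> Units R \<and> generate (units_of R) S = Units R)"

definition polys_over :: "'a::comm_ring_1 set \<Rightarrow> 'a poly set" where
  "polys_over R = {p. \<forall>i. Polynomial.coeff p i \<in> R}"

text \<open>Square-freeness in \<open>R[t]\<close> also forbids squares of constants of \<open>R\<close>
  that are not units of \<open>R\<close>.\<close>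

definition squarefree_in :: "('a, 'b) monoid_scheme \<Rightarrow> 'a \<Rightarrow> bool" where
  "squarefree_in G h \<longleftrightarrow>
     (\<forall>g\<in>carrier G. (g \<otimes>\<^bsub>G\<^esub> g) divides\<^bsub>G\<^esub> h \<longrightarrow> g \<in> Units G)"

section \<open>Weierstrass curves\<close>

text \<open>The equation \<open>y\<^sup>2 + a1 x y + a3 y = x\<^sup>3 + a2 x\<^sup>2 + a4 x + a6\<close>.\<close>

datatype 'a weierstrass =
  Weierstrass (wa1: 'a) (wa2: 'a) (wa3: 'a) (wa4: 'a) (wa6: 'a)

definition weierstrass_eqn :: "'a::comm_ring_1 weierstrass \<Rightarrow> 'a \<Rightarrow> 'a \<Rightarrow> 'a" where
  "weierstrass_eqn W x y =
     y^2 + wa1 W * x * y + wa3 W * y - (x^3 + wa2 W * x^2 + wa4 W * x + wa6 W)"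

definition discriminant :: "'a::comm_ring_1 weierstrass \<Rightarrow> 'a" where
  "discriminant W =
     (let b2 = wa1 W ^ 2 + 4 * wa2 W;
          b4 = 2 * wa4 W + wa1 W * wa3 W;
          b6 = wa3 W ^ 2 + 4 * wa6 W;
          b8 = wa1 W ^ 2 * wa6 W + 4 * wa2 W * wa6 W - wa1 W * wa3 W * wa4 W
               + wa2 W * wa3 W ^ 2 - wa4 W ^ 2
      in - (b2^2 * b8) - 8 * b4^3 - 27 * b6^2 + 9 * b2 * b4 * b6)"

definition elliptic_curve :: "'a::field weierstrass \<Rightarrow> bool" where
  "elliptic_curve W \<longleftrightarrow> discriminant W \<noteq> 0"

text \<open>Isomorphisms of elliptic curves in Weierstrass form are the admissible changes of
  variables \<open>x = u\<^sup>2 x' + r\<close>, \<open>y = u\<^sup>3 y' + u\<^sup>2 s x' + v\<close>; the formulas compare the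
  coefficients of the two equations (Silverman, The Arithmetic of Elliptic Curves, III.1).\<close>

definition isomorphic_curves :: "'a::field weierstrass \<Rightarrow> 'a weierstrass \<Rightarrow> bool" where
  "isomorphic_curves W W' \<longleftrightarrow>
     (\<exists>u r s v. u \<noteq> 0 \<and>
        u * wa1 W' = wa1 W + 2 * s \<and>
        u^2 * wa2 W' = wa2 W - s * wa1 W + 3 * r - s^2 \<and>
        u^3 * wa3 W' = wa3 W + r * wa1 W + 2 * v \<and>
        u^4 * wa4 W' = wa4 W - s * wa3 W + 2 * r * wa2 W - (v + r * s) * wa1 W
                       + 3 * r^2 - 2 * s * v \<and>
        u^6 * wa6 W' = wa6 W + r * wa4 W + r^2 * wa2 W + r^3 - v * wa3 W - v^2
                       - r * v * wa1 W)"

datatype 'a point = Infinity | Affine 'a 'a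

definition curve_points :: "'a::field weierstrass \<Rightarrow> 'a point set" where
  "curve_points W = insert Infinity {Affine x y | x y. weierstrass_eqn W x y = 0}"

text \<open>The chord-and-tangent law.\<close>

fun point_add :: "'a::field weierstrass \<Rightarrow> 'a point \<Rightarrow> 'a point \<Rightarrow> 'a point" where
  "point_add W Infinity Q = Q"
| "point_add W P Infinity = P"
| "point_add W (Affine x1 y1) (Affine x2 y2) =
     (if x1 = x2 \<and> y1 + y2 + wa1 W * x1 + wa3 W = 0 then Infinity
      else let l = (if x1 = x2
                    then (3 * x1^2 + 2 * wa2 W * x1 + wa4 W - wa1 W * y1)
                         / (2 * y1 + wa1 W * x1 + wa3 W)
                    else (y2 - y1) / (x2 - x1));
               x3 = l^2 + wa1 W * l - wa2 W - x1 - x2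
           in Affine x3 (- (l * (x3 - x1) + y1) - wa1 W * x3 - wa3 W))"

definition curve_group :: "'a::field weierstrass \<Rightarrow> 'a point monoid" where
  "curve_group W = \<lparr>carrier = curve_points W, monoid.mult = point_add W, one = Infinity\<rparr>"

section \<open>Curves over \<open>K(t)\<close> and specialization\<close>

text \<open>The expansion of \<open>y\<^sup>2 = (x - e1) (x - e2) (x - e3)\<close>.\<close>

definition curve_of_roots :: "'a::comm_ring_1 \<Rightarrow> 'a \<Rightarrow> 'a \<Rightarrow> 'a weierstrass" where
  "curve_of_roots e1 e2 e3 =
     Weierstrass 0 (- (e1 + e2 + e3)) 0 (e1 * e2 + e1 * e3 + e2 * e3) (- (e1 * e2 * e3))"

text \<open>A curve with coefficients in \<open>K[t]\<close>, regarded over \<open>K(t)\<close>, respectively with \<open>t = t0\<close>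
  substituted in the coefficients.\<close>

definition generic_curve :: "'k::field poly weierstrass \<Rightarrow> 'k poly fract weierstrass" where
  "generic_curve W = map_weierstrass to_fract W"

definition special_curve :: "'k::field \<Rightarrow> 'k poly weierstrass \<Rightarrow> 'k weierstrass" where
  "special_curve t0 W = map_weierstrass (\<lambda>p. poly p t0) W"

definition nonconstant_curve :: "'k::field_char_0 poly fract weierstrass \<Rightarrow> bool" where
  "nonconstant_curve W \<longleftrightarrow>
     \<not> (\<exists>W0 :: 'k weierstrass. elliptic_curve W0 \<and>
          isomorphic_curves W (map_weierstrass (\<lambda>c. to_fract [:c:]) W0))"

definition regular_at :: "'k::field \<Rightarrow> 'k poly fract \<Rightarrow> bool" where
  "regular_at t0 f \<longleftrightarrow> (\<exists>p q. poly q t0 \<noteq> 0 \<and> f = Fraction_Field.Fract p q)"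

definition fract_eval :: "'k::field \<Rightarrow> 'k poly fract \<Rightarrow> 'k" where
  "fract_eval t0 f =
     (THE v. \<exists>p q. poly q t0 \<noteq> 0 \<and> f = Fraction_Field.Fract p q \<and> v = poly p t0 / poly q t0)"

text \<open>For a point of a curve whose coefficients are regular at \<open>t0\<close>, either both coordinates
  are regular at \<open>t0\<close>, or both have a pole there, that of \<open>y\<close> being of larger order; in the
  latter case the point reduces to \<open>[0 : 1 : 0]\<close>.\<close>

fun specialization :: "'k::field \<Rightarrow> 'k poly fract point \<Rightarrow> 'k point" where
  "specialization t0 Infinity = Infinity"
| "specialization t0 (Affine x y) =
     (if regular_at t0 x \<and> regular_at t0 y
      then Affine (fract_eval t0 x) (fract_eval t0 y) else Infinity)"

end

(*
Reduction at t0 is a homomorphism because E reduces to a nonsingular cubic: by Gauss's lemma R[t] is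
factorial with fraction field K(t), so if ei(t0) = ej(t0), some prime of R[t] dividing ei - ej vanishes
at t0 and its value 0 is a square, against (C).

Let (x, y) reduce to infinity. Then x - ei = h s^2 with h squarefree in R[t] and dividing
(ei - ej) (ei - ek). Comparing leading coefficients at t0 shows that h(t0) is a square, so by (C) h is
constant and x - ei is a square ai^2. Choose the signs of the ai so that aj / ai has value 1 at t0. The
point with x' = x + a1 a2 + a1 a3 + a2 a3, a half of (x, y), again reduces to infinity, since
x' - e1 = (a1 + a2) (a1 + a3), and the leading coefficient of x' at t0 is 4 times that of x. Iterating
gives infinitely many triples (a1, a2, a3) with one common denominator Z, as R[t] is integrally closed.
Because (Z a1 + Z aj) (Z a1 - Z aj) = (ej - e1) Z^2, two of the triples have the same Z a1 + Z a2 and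
Z a1 + Z a3 up to units, and these units, being constants, are determined by the leading coefficients,
so that they coincide. Then a3 - a2 is scaled by this unit and by its inverse, so the unit squares to 1;
but its square is a positive power of 4.
*)

theory Submission
  imports Defs
begin

section \<open>Factorial subrings\<close>

text \<open>Under (C) the kernel of reduction is 2-divisible: the 2-torsion is rational, so a point
  is a double as soon as all \<open>x - ei\<close> are squares, and exactly one of its four halves
  reduces to infinity. Endless halving must be set against some finiteness. Heights or finite
  generation of E(K(t)) would supply one; here it is the elementary fact that an element of a
  factorial ring has finitely many divisors up to units. The units are then the only freedom left,
  and the factor 4 removes it: doubling multiplies the local parameter x/y at infinity by 2 to first
  order, and x is to first order the inverse square of that parameter, so each halving multiplies
  the leading coefficient of x by 4, and no positive power of 4 is 1 in characteristic 0. No Laurent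
  series occur: leading coefficients are compared only through quotients regular at t0. A constant h
  lies outside (C), but it equals its own value at t0. So the descent needs only this form of (C): a
  squarefree divisor h whose value at t0 is a square is itself a square.\<close>

definition divides_in :: "'a::comm_ring_1 set \<Rightarrow> 'a \<Rightarrow> 'a \<Rightarrow> bool" where
  "divides_in A a b \<longleftrightarrow> (\<exists>c\<in>A. b = a * c)"

definition unit_in :: "'a::comm_ring_1 set \<Rightarrow> 'a \<Rightarrow> bool" where
  "unit_in A u \<longleftrightarrow> u \<in> A \<and> (\<exists>v\<in>A. u * v = 1)"

definition prime_in :: "'a::comm_ring_1 set \<Rightarrow> 'a \<Rightarrow> bool" where
  "prime_in A p \<longleftrightarrow> p \<in> A \<and> p \<noteq> 0 \<and> \<not> unit_in A p \<and>
     (\<forall>a\<in>A. \<forall>b\<in>A. divides_in A p (a * b) \<longrightarrow> divides_in A p a \<or> divides_in A p b)"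

definition sqfree_in :: "'a::comm_ring_1 set \<Rightarrow> 'a \<Rightarrow> bool" where
  "sqfree_in A h \<longleftrightarrow> (\<forall>g\<in>A. divides_in A (g * g) h \<longrightarrow> unit_in A g)"

text \<open>The factors are prime, not merely irreducible, so the existence of such a product for
  every nonzero element already characterizes factorial domains, and proofs can remove one prime at
  a time.\<close>

inductive prime_product :: "'a::comm_ring_1 set \<Rightarrow> 'a \<Rightarrow> bool" for A where
  unit: "unit_in A u \<Longrightarrow> prime_product A u"
| mult: "prime_in A p \<Longrightarrow> prime_product A a \<Longrightarrow> prime_product A (p * a)"

text \<open>The ring is a subset of an ambient domain, so that R in K, R[t] in K[t] and the image of
  R[t] in K(t) are all instances.\<close>

locale subring_set =
  fixes A :: "'a::idom set"
  assumes one_mem: "1 \<in> A"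
    and diff_mem: "a \<in> A \<Longrightarrow> b \<in> A \<Longrightarrow> a - b \<in> A"
    and mult_mem: "a \<in> A \<Longrightarrow> b \<in> A \<Longrightarrow> a * b \<in> A"
begin

lemma zero_mem: "0 \<in> A"
  using diff_mem[OF one_mem one_mem] by simp

lemma uminus_mem: "a \<in> A \<Longrightarrow> - a \<in> A"
  using diff_mem[OF zero_mem] by force

lemma add_mem: "a \<in> A \<Longrightarrow> b \<in> A \<Longrightarrow> a + b \<in> A"
  using diff_mem[of a "- b"] uminus_mem by simp

lemma power_mem: "a \<in> A \<Longrightarrow> a ^ n \<in> A"
  by (induction n) (auto simp: one_mem mult_mem)

lemma sum_mem: "(\<And>i. i \<in> I \<Longrightarrow> f i \<in> A) \<Longrightarrow> sum f I \<in> A"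
  by (induction I rule: infinite_finite_induct) (auto simp: zero_mem add_mem)

lemma unit_in_mem: "unit_in A u \<Longrightarrow> u \<in> A"
  by (simp add: unit_in_def)

lemma prime_in_mem: "prime_in A p \<Longrightarrow> p \<in> A"
  by (simp add: prime_in_def)

lemma unit_in_one: "unit_in A 1"
  by (auto simp: unit_in_def one_mem)

lemma unit_in_neq_0: "unit_in A u \<Longrightarrow> u \<noteq> 0"
  by (auto simp: unit_in_def)

lemma unit_in_mult: "unit_in A u \<Longrightarrow> unit_in A v \<Longrightarrow> unit_in A (u * v)"
  unfolding unit_in_def by (metis mult.assoc mult.left_commute mult_mem mult_1_right)

lemma unit_in_multD: "unit_in A (a * b) \<Longrightarrow> a \<in> A \<Longrightarrow> b \<in> A \<Longrightarrow> unit_in A a"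
  unfolding unit_in_def by (metis mult.assoc mult_mem)

lemma prime_inD:
  assumes "prime_in A p" "divides_in A p (a * b)" "a \<in> A" "b \<in> A"
  shows "divides_in A p a \<or> divides_in A p b"
  using assms by (simp add: prime_in_def)

lemma divides_in_trans: "divides_in A a b \<Longrightarrow> divides_in A b c \<Longrightarrow> divides_in A a c"
  unfolding divides_in_def by (metis mult.assoc mult_mem)

lemma divides_in_mult: "divides_in A a b \<Longrightarrow> c \<in> A \<Longrightarrow> divides_in A a (b * c)"
  unfolding divides_in_def by (metis mult.assoc mult_mem)

lemma divides_in_diff: "divides_in A a b \<Longrightarrow> divides_in A a c \<Longrightarrow> divides_in A a (b - c)"
  unfolding divides_in_def by (metis diff_mem right_diff_distrib)

lemma divides_in_mult_cancel: "c \<noteq> 0 \<Longrightarrow> divides_in A (c * a) (c * b) \<Longrightarrow> divides_in A a b"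
  by (auto simp: divides_in_def mult.assoc)

lemma prime_in_neq_0: "prime_in A p \<Longrightarrow> p \<noteq> 0"
  by (simp add: prime_in_def)

lemma prime_product_mem: "prime_product A a \<Longrightarrow> a \<in> A \<and> a \<noteq> 0"
  by (induction rule: prime_product.induct)
     (simp_all add: unit_in_neq_0 unit_in_mem prime_in_mem prime_in_neq_0 mult_mem)

lemma prime_product_unit_mult: "prime_product A a \<Longrightarrow> unit_in A u \<Longrightarrow> prime_product A (u * a)"
  by (induction rule: prime_product.induct)
     (auto simp: mult.left_commute[of u] intro: prime_product.intros unit_in_mult)

lemma prime_product_mult: "prime_product A a \<Longrightarrow> prime_product A b \<Longrightarrow> prime_product A (a * b)"
  by (induction rule: prime_product.induct)
     (auto simp: mult.assoc intro: prime_product.intros prime_product_unit_mult)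

text \<open>Since \<open>p = g * (g * c)\<close>, the prime \<open>p\<close> divides
  \<open>g\<close> or \<open>g * c\<close>; cancelling \<open>p\<close> leaves an inverse of
  \<open>g\<close> either way. This makes condition (C) applicable to primes.\<close>

lemma prime_in_sqfree:
  assumes p: "prime_in A p"
  shows "sqfree_in A p"
  unfolding sqfree_in_def
proof (intro ballI impI)
  fix g assume g: "g \<in> A" and "divides_in A (g * g) p"
  then obtain c where c: "c \<in> A" "p = g * (g * c)"
    by (auto simp: divides_in_def mult.assoc)
  have nz: "g \<noteq> 0" "p \<noteq> 0" using c p by (auto simp: prime_in_def)
  have "divides_in A p (g * (g * c))"
    using c one_mem by (auto simp: divides_in_def)
  then consider "divides_in A p g" | "divides_in A p (g * c)"
    using prime_inD[OF p _ g mult_mem[OF g c(1)]] by blast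
  then show "unit_in A g"
  proof cases
    case 1
    then obtain d where d: "d \<in> A" "g = p * d" by (auto simp: divides_in_def)
    have "p * (g * (d * c)) = p * d * (g * c)" by (simp add: ac_simps)
    also have "\<dots> = p * 1" unfolding d(2)[symmetric] c(2)[symmetric] by simp
    finally have "g * (d * c) = 1" using nz(2) mult_left_cancel by blast
    then show ?thesis unfolding unit_in_def using g mult_mem[OF d(1) c(1)] by blast
  next
    case 2
    then obtain d where d: "d \<in> A" "g * c = p * d" by (auto simp: divides_in_def)
    have "p * (g * d) = g * (p * d)" by (rule mult.left_commute)
    also have "\<dots> = p * 1" unfolding d(2)[symmetric] c(2)[symmetric] by simp
    finally have "g * d = 1" using nz(2) mult_left_cancel by blast
    then show ?thesis using g d(1) by (auto simp: unit_in_def)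
  qed
qed

lemma sqfree_in_dvd: "sqfree_in A h \<Longrightarrow> divides_in A g h \<Longrightarrow> sqfree_in A g"
  unfolding sqfree_in_def using divides_in_trans by blast

text \<open>If \<open>p\<close> divided \<open>g\<close>, then \<open>p^2\<close> would divide
  \<open>p * h\<close> and \<open>p\<close> would divide \<open>h\<close>. So \<open>p\<close> sits
  in the cofactor of \<open>g * g\<close> and cancels, leaving a square divisor of
  \<open>h\<close>.\<close>

lemma sqfree_in_prime_mult:
  assumes p: "prime_in A p" and h: "sqfree_in A h" "h \<in> A" and ndvd: "\<not> divides_in A p h"
  shows "sqfree_in A (p * h)"
  unfolding sqfree_in_def
proof (intro ballI impI)
  fix g assume g: "g \<in> A" and "divides_in A (g * g) (p * h)"
  then obtain c where c: "c \<in> A" "p * h = g * g * c"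
    by (auto simp: divides_in_def)
  have p0: "p \<noteq> 0" using p by (simp add: prime_in_def)
  have npg: "\<not> divides_in A p g"
  proof
    assume "divides_in A p g"
    then obtain d where d: "d \<in> A" "g = p * d" by (auto simp: divides_in_def)
    then have "p * h = p * (p * (d * d * c))" using c(2) by (simp add: ac_simps)
    then have "h = p * (d * d * c)" using p0 by (metis mult_left_cancel)
    then show False using ndvd d c mult_mem by (auto simp: divides_in_def)
  qed
  have "divides_in A p (g * g * c)" using c(2) h(2) by (metis divides_in_def)
  then have "divides_in A p c"
    using npg prime_inD[OF p] g c(1) mult_mem by blast
  then obtain d where d: "d \<in> A" "c = p * d" by (auto simp: divides_in_def)
  then have "p * h = p * (g * g * d)" using c(2) by (simp add: ac_simps)
  then have "h = g * g * d" using p0 by (metis mult_left_cancel)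
  then show "unit_in A g" using h(1) g d(1) by (auto simp: sqfree_in_def divides_in_def)
qed

text \<open>A new prime \<open>p\<close> either joins \<open>h\<close> or, if \<open>h\<close>
  already contains it, moves from \<open>h\<close> into \<open>s\<close>:
  \<open>p * h * s^2 = (h / p) * (p * s)^2\<close>.\<close>

lemma prime_product_sqfree_part:
  "prime_product A a \<Longrightarrow> \<exists>h\<in>A. \<exists>s\<in>A. sqfree_in A h \<and> a = h * s\<^sup>2"
proof (induction rule: prime_product.induct)
  case (unit u)
  then have "sqfree_in A u"
    unfolding sqfree_in_def divides_in_def by (metis mult_mem unit_in_multD)
  moreover have "u = u * 1\<^sup>2" by simp
  ultimately show ?case using unit_in_mem[OF unit] one_mem by blast
next
  case (mult p a)
  then obtain h s where h: "h \<in> A" "s \<in> A" "sqfree_in A h" "a = h * s\<^sup>2" by blast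
  note p = prime_in_mem[OF mult(1)]
  show ?case
  proof (cases "divides_in A p h")
    case True
    then obtain d where d: "d \<in> A" "h = p * d" by (auto simp: divides_in_def)
    then have "divides_in A d h" using p by (auto simp: divides_in_def mult.commute)
    then have "sqfree_in A d" using h(3) sqfree_in_dvd by blast
    moreover have "p * a = d * (p * s)\<^sup>2" using h d by (simp add: power2_eq_square ac_simps)
    ultimately show ?thesis using d(1) mult_mem[OF p h(2)] by blast
  next
    case False
    have "p * a = (p * h) * s\<^sup>2" using h by (simp add: ac_simps)
    then show ?thesis using sqfree_in_prime_mult[OF mult(1) h(3,1) False] mult_mem[OF p h(1)] h(2)
      by blast
  qed
qed

text \<open>Primes of \<open>b\<close> are removed one by one: \<open>p\<close> divides
  \<open>a^2\<close>, hence \<open>a\<close>. This is integral closedness in the case of square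
  roots.\<close>

lemma prime_product_root_closed:
  "prime_product A b \<Longrightarrow> a \<in> A \<Longrightarrow> divides_in A (b\<^sup>2) (a\<^sup>2) \<Longrightarrow> divides_in A b a"
proof (induction arbitrary: a rule: prime_product.induct)
  case (unit u)
  then obtain v where v: "v \<in> A" "u * v = 1" by (auto simp: unit_in_def)
  then have "a = u * (v * a)" by (metis mult.assoc mult_1)
  then show ?case unfolding divides_in_def using mult_mem[OF v(1) unit(2)] by blast
next
  case (mult p b)
  then obtain c where c: "c \<in> A" "a * a = (p * b)\<^sup>2 * c"
    by (auto simp: divides_in_def power2_eq_square)
  have p0: "p \<noteq> 0" and p: "p \<in> A" using mult(1) by (auto simp: prime_in_def)
  have b: "b \<in> A" using mult(2) prime_product_mem by blast
  have "a * a = p * (p * b\<^sup>2 * c)" using c(2) by (simp add: power2_eq_square ac_simps)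
  moreover have "p * b\<^sup>2 * c \<in> A" using p b c(1) mult_mem power_mem by blast
  ultimately have "divides_in A p (a * a)" by (auto simp: divides_in_def)
  then have "divides_in A p a" using prime_inD[OF mult(1)] mult(4) by blast
  then obtain d where d: "d \<in> A" "a = p * d" by (auto simp: divides_in_def)
  have "p\<^sup>2 * d\<^sup>2 = p\<^sup>2 * (b\<^sup>2 * c)" using c(2) d(2) by (simp add: power2_eq_square ac_simps)
  then have "d\<^sup>2 = b\<^sup>2 * c" using p0 by simp
  then have "divides_in A b d" using mult(3)[OF d(1)] c(1) by (auto simp: divides_in_def)
  then show ?case using d(2) by (auto simp: divides_in_def mult.assoc)
qed

text \<open>Each prime at most doubles the set of representatives: a divisor of \<open>p * a\<close>
  containing \<open>p\<close> is \<open>p\<close> times a divisor of \<open>a\<close>, and otherwise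
  \<open>p\<close> falls to its cofactor. This is the finiteness that stops the descent.\<close>

lemma prime_product_finite_divisors:
  "prime_product A f \<Longrightarrow> \<exists>S. finite S \<and> S \<subseteq> A \<and>
     (\<forall>d\<in>A. divides_in A d f \<longrightarrow> (\<exists>s\<in>S. \<exists>u. unit_in A u \<and> d = u * s))"
proof (induction rule: prime_product.induct)
  case (unit u)
  have "unit_in A d" if "d \<in> A" "divides_in A d u" for d
    using that unit unit_in_multD unfolding divides_in_def by blast
  then have "\<forall>d\<in>A. divides_in A d u \<longrightarrow> (\<exists>s\<in>{1}. \<exists>u. unit_in A u \<and> d = u * s)" by simp
  then show ?case using one_mem by blast
next
  case (mult p a)
  then obtain S where S: "finite S" "S \<subseteq> A"
    "\<And>d. d \<in> A \<Longrightarrow> divides_in A d a \<Longrightarrow> (\<exists>s\<in>S. \<exists>u. unit_in A u \<and> d = u * s)" by blast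
  have p0: "p \<noteq> 0" and p: "p \<in> A" using mult(1) by (auto simp: prime_in_def)
  have a: "a \<in> A" using mult(2) prime_product_mem by blast
  have "\<exists>s\<in>S \<union> (*) p ` S. \<exists>u. unit_in A u \<and> d = u * s"
    if d: "d \<in> A" "divides_in A d (p * a)" for d
  proof (cases "divides_in A p d")
    case True
    then obtain e where e: "e \<in> A" "d = p * e" by (auto simp: divides_in_def)
    then have "divides_in A e a" using d(2) p0 divides_in_mult_cancel by blast
    then obtain s u where "s \<in> S" "unit_in A u" "e = u * s" using S(3) e(1) by blast
    then have "p * s \<in> (*) p ` S" "d = u * (p * s)" using e(2) by auto
    then show ?thesis using \<open>unit_in A u\<close> by blast
  next
    case False
    obtain c where c: "c \<in> A" "p * a = d * c" using d(2) by (auto simp: divides_in_def)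
    then have "divides_in A p (d * c)" using a by (metis divides_in_def)
    then have "divides_in A p c" using False prime_inD[OF mult(1)] d(1) c(1) by blast
    then obtain e where e: "e \<in> A" "c = p * e" by (auto simp: divides_in_def)
    then have "p * a = p * (d * e)" using c(2) by (simp add: ac_simps)
    then have "a = d * e" using p0 by simp
    then have "divides_in A d a" using e(1) unfolding divides_in_def by blast
    then show ?thesis using S(3) d(1) by blast
  qed
  moreover have "finite (S \<union> (*) p ` S)" "S \<union> (*) p ` S \<subseteq> A" using S p mult_mem by auto
  ultimately show ?case by blast
qed

text \<open>Squarefreeness keeps \<open>p\<close> out of the remaining product \<open>a\<close>, so
  once \<open>a\<close> divides \<open>F\<close>, the prime \<open>p\<close> must divide the
  quotient. Divisibility is thus tested at single primes.\<close>

lemma sqfree_dividesI: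
  "prime_product A h \<Longrightarrow> sqfree_in A h \<Longrightarrow> F \<in> A \<Longrightarrow>
    (\<And>p. prime_in A p \<Longrightarrow> divides_in A p h \<Longrightarrow> divides_in A p F) \<Longrightarrow> divides_in A h F"
proof (induction rule: prime_product.induct)
  case (unit u)
  then obtain v where v: "v \<in> A" "u * v = 1" by (auto simp: unit_in_def)
  then have "F = u * (v * F)" by (metis mult.assoc mult_1)
  then show ?case unfolding divides_in_def using mult_mem[OF v(1) unit(3)] by blast
next
  case (mult p a)
  have p: "p \<in> A" and a: "a \<in> A" and p0: "p \<noteq> 0" 
    using mult(1,2) prime_product_mem by (auto simp: prime_in_def)
  have dvd: "divides_in A p (p * a)" "divides_in A a (p * a)"
    using p a by (auto simp: divides_in_def mult.commute)
  have npa: "\<not> divides_in A p a"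
  proof
    assume "divides_in A p a"
    then have "divides_in A (p * p) (p * a)" by (auto simp: divides_in_def mult.assoc)
    then show False using mult(1,4) p by (auto simp: sqfree_in_def prime_in_def)
  qed
  have "sqfree_in A a" using mult(4) dvd(2) sqfree_in_dvd by blast
  then have "divides_in A a F" using mult divides_in_trans dvd by blast
  then obtain c where c: "c \<in> A" "F = a * c" by (auto simp: divides_in_def)
  have "divides_in A p (a * c)" using mult(6) mult(1) dvd(1) c by blast
  then have "divides_in A p c" using prime_inD[OF mult(1)] npa a c(1) by blast
  then show ?case using c(2) by (auto simp: divides_in_def ac_simps)
qed

end

locale ufd_subring = subring_set +
  assumes factorable: "a \<in> A \<Longrightarrow> a \<noteq> 0 \<Longrightarrow> prime_product A a"

section \<open>Gauss's lemma\<close>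

lemma divides_in_const_iff:
  fixes R :: "'k::field set"
  assumes "c \<noteq> 0"
  shows "divides_in (polys_over R) [:c:] f \<longleftrightarrow> (\<forall>i. divides_in R c (Polynomial.coeff f i))"
proof
  assume "\<forall>i. divides_in R c (Polynomial.coeff f i)"
  then have "inverse c * Polynomial.coeff f i \<in> R" for i
    using assms by (auto simp: divides_in_def mult.assoc[symmetric] dest!: spec[of _ i])
  then have "smult (inverse c) f \<in> polys_over R" by (simp add: polys_over_def)
  moreover have "f = [:c:] * smult (inverse c) f" using assms by simp
  ultimately show "divides_in (polys_over R) [:c:] f" unfolding divides_in_def by blast
qed (auto simp: divides_in_def polys_over_def)

locale ufd_in_field = ufd_subring R for R :: "'k::field set" +
  assumes frac: "\<exists>a\<in>R. \<exists>b\<in>R. b \<noteq> 0 \<and> b * x = a"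
begin

abbreviation "Rt \<equiv> polys_over R"

lemma const_mem_iff: "[:c:] \<in> Rt \<longleftrightarrow> c \<in> R"
  by (auto simp: polys_over_def coeff_pCons zero_mem split: nat.split)

sublocale poly: subring_set Rt
proof
  show "1 \<in> Rt" using one_mem zero_mem by (simp add: polys_over_def)
  show "a - b \<in> Rt" if "a \<in> Rt" "b \<in> Rt" for a b
    using that diff_mem by (simp add: polys_over_def)
  show "a * b \<in> Rt" if "a \<in> Rt" "b \<in> Rt" for a b
    using that mult_mem by (simp add: polys_over_def coeff_mult sum_mem)
qed

lemma smult_mem: "c \<in> R \<Longrightarrow> f \<in> Rt \<Longrightarrow> smult c f \<in> Rt"
  by (simp add: polys_over_def mult_mem)

text \<open>Degrees add, so units are constants; later this recovers a unit from its value at one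
  point.\<close>

lemma unit_in_poly_iff: "unit_in Rt u \<longleftrightarrow> (\<exists>c. u = [:c:] \<and> unit_in R c)"
proof
  assume "unit_in Rt u"
  then obtain v where v: "u \<in> Rt" "v \<in> Rt" "u * v = 1" by (auto simp: unit_in_def)
  then have nz: "u \<noteq> 0" "v \<noteq> 0" by auto
  then have "Polynomial.degree u + Polynomial.degree v = 0"
    using v(3) degree_mult_eq[OF nz] by simp
  then obtain c d where "u = [:c:]" "v = [:d:]" by (metis add_is_0 degree_0_id)
  then show "\<exists>c. u = [:c:] \<and> unit_in R c"
    using v by (auto simp: unit_in_def const_mem_iff one_pCons mult.commute)
next
  assume "\<exists>c. u = [:c:] \<and> unit_in R c"
  then obtain c d where "u = [:c:]" "c \<in> R" "d \<in> R" "c * d = 1" by (auto simp: unit_in_def)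
  then have "u \<in> Rt" "[:d:] \<in> Rt" "u * [:d:] = 1"
    by (simp_all add: const_mem_iff one_pCons mult.commute)
  then show "unit_in Rt u" unfolding unit_in_def by blast
qed

text \<open>Gauss's argument: let \<open>i\<close> and \<open>j\<close> be the least indices whose
  coefficients in \<open>f\<close> and \<open>g\<close> are not divisible by \<open>c\<close>. In
  the coefficient of \<open>f * g\<close> at \<open>i + j\<close>, every term but one is divisible
  by \<open>c\<close>.\<close>

lemma prime_in_const:
  assumes c: "prime_in R c"
  shows "prime_in Rt [:c:]"
  unfolding prime_in_def
proof (intro conjI ballI impI)
  have c0: "c \<noteq> 0" using c by (rule prime_in_neq_0)
  then show "[:c:] \<noteq> 0" by simp
  show "[:c:] \<in> Rt" using c by (simp add: const_mem_iff prime_in_mem)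
  show "\<not> unit_in Rt [:c:]" using c by (auto simp: unit_in_poly_iff prime_in_def)
  fix f g assume fg: "f \<in> Rt" "g \<in> Rt" "divides_in Rt [:c:] (f * g)"
  show "divides_in Rt [:c:] f \<or> divides_in Rt [:c:] g"
  proof (rule ccontr)
    assume "\<not> ?thesis"
    then have "\<exists>i. \<not> divides_in R c (Polynomial.coeff f i)"
      "\<exists>i. \<not> divides_in R c (Polynomial.coeff g i)"
      using c0 by (auto simp: divides_in_const_iff)
    then obtain i j where i: "\<not> divides_in R c (Polynomial.coeff f i)"
      "\<And>k. k < i \<Longrightarrow> divides_in R c (Polynomial.coeff f k)"
      and j: "\<not> divides_in R c (Polynomial.coeff g j)"
        "\<And>k. k < j \<Longrightarrow> divides_in R c (Polynomial.coeff g k)"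
      using exists_least_iff[of "\<lambda>i. \<not> divides_in R c (Polynomial.coeff f i)"]
        exists_least_iff[of "\<lambda>i. \<not> divides_in R c (Polynomial.coeff g i)"] by blast
    have mem: "Polynomial.coeff f k \<in> R" "Polynomial.coeff g k \<in> R" for k using fg
      by (auto simp: polys_over_def)
    define h where "h k = Polynomial.coeff f k * Polynomial.coeff g (i + j - k)" for k
    have sum_dvd: "divides_in R c (sum h I)" if "\<And>k. k \<in> I \<Longrightarrow> divides_in R c (h k)" for I
    proof -
      have "\<exists>q. \<forall>k\<in>I. q k \<in> R \<and> h k = c * q k" using that unfolding divides_in_def by metis
      then obtain q where q: "\<And>k. k \<in> I \<Longrightarrow> q k \<in> R" "\<And>k. k \<in> I \<Longrightarrow> h k = c * q k" by blast
      then have "sum h I = c * sum q I" by (simp add: sum_distrib_left)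
      then show ?thesis using sum_mem[of I q] q(1) unfolding divides_in_def by blast
    qed
    have "divides_in R c (h k)" if "k \<in> {..i + j} - {i}" for k
    proof (cases "k < i")
      case True
      then show ?thesis unfolding h_def using divides_in_mult i(2) mem by blast
    next
      case False
      then have "i + j - k < j" using that by auto
      then show ?thesis unfolding h_def using divides_in_mult j(2) mem by (metis mult.commute)
    qed
    then have "divides_in R c (sum h ({..i + j} - {i}))" by (rule sum_dvd)
    moreover have "divides_in R c (Polynomial.coeff (f * g) (i + j))"
      using fg(3) c0 by (simp add: divides_in_const_iff)
    moreover have "Polynomial.coeff (f * g) (i + j) = h i + sum h ({..i + j} - {i})"
      unfolding coeff_mult h_def by (subst sum.remove[of _ i]) auto
    ultimately have "divides_in R c (h i)" using divides_in_diff by fastforce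
    then show False using prime_inD[OF c] i(1) j(1) mem by (auto simp: h_def)
  qed
qed

lemma prime_product_const: "prime_product R c \<Longrightarrow> prime_product Rt [:c:]"
proof (induction rule: prime_product.induct)
  case (unit u)
  then show ?case by (intro prime_product.unit) (simp add: unit_in_poly_iff)
next
  case (mult p a)
  have "[:p * a:] = [:p:] * [:a:]" by simp
  then show ?case using mult prime_in_const prime_product.mult by metis
qed

text \<open>Cancels one prime of a common denominator; it is the induction step of both
  \<open>gauss_factorization\<close> and \<open>primitive_divides\<close>.\<close>

lemma prime_const_dividesD:
  assumes p: "prime_in R p" and f: "f \<in> Rt" "g \<in> Rt" "smult (p * a) h = f * g" "a \<in> R" "h \<in> Rt"
  shows "(\<exists>f'\<in>Rt. f = smult p f' \<and> smult a h = f' * g) \<or> (\<exists>g'\<in>Rt. g = smult p g' \<and>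
    smult a h = f * g')"
proof -
  have p0: "p \<noteq> 0" using p by (rule prime_in_neq_0)
  have "f * g = [:p:] * smult a h" unfolding f(3)[symmetric] by (simp add: mult.commute)
  then have "divides_in Rt [:p:] (f * g)" using smult_mem[OF f(4,5)] unfolding divides_in_def
    by blast
  then consider f' where "f' \<in> Rt" "f = [:p:] * f'" | g' where "g' \<in> Rt" "g = [:p:] * g'"
    using poly.prime_inD[OF prime_in_const[OF p] _ f(1,2)] unfolding divides_in_def by blast
  then show ?thesis
  proof cases
    case 1
    then have "smult p (smult a h) = smult p (f' * g)" using f(3) by simp
    then have "smult a h = f' * g" using p0 smult_cancel by blast
    moreover have "f = smult p f'" using 1 by simp
    ultimately show ?thesis using 1(1) by blast
  next
    case 2
    then have "smult p (smult a h) = smult p (f * g')" using f(3) by simp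
    then have "smult a h = f * g'" using p0 smult_cancel by blast
    moreover have "g = smult p g'" using 2 by simp
    ultimately show ?thesis using 2(1) by blast
  qed
qed

text \<open>A factorization over the field, with denominators cleared by \<open>c\<close>, is
  brought back to \<open>Rt\<close> by removing the primes of \<open>c\<close> one at a time. Only
  constants move, so the degrees stay.\<close>

lemma gauss_factorization:
  assumes "prime_product R c" "f \<in> Rt" "u \<in> Rt" "v \<in> Rt" "smult c f = u * v"
  shows "\<exists>u'\<in>Rt. \<exists>v'\<in>Rt. f = u' * v' \<and> Polynomial.degree u' = Polynomial.degree u \<and>
    Polynomial.degree v' = Polynomial.degree v"
  using assms
proof (induction arbitrary: u v rule: prime_product.induct)
  case (unit c)
  then obtain d where d: "d \<in> R" "d * c = 1" by (auto simp: unit_in_def mult.commute)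
  then have "f = smult d u * v" using unit(5) by (metis mult_smult_left smult_1_left smult_smult)
  moreover have "d \<noteq> 0" using d by auto
  ultimately show ?case using smult_mem[OF d(1) unit(3)] unit(4) by (metis degree_smult_eq)
next
  case (mult p a)
  have p0: "p \<noteq> 0" and a: "a \<in> R" using mult(1,2) prime_in_neq_0 prime_product_mem by auto
  from prime_const_dividesD[OF mult(1,5,6,7) a mult(4)] show ?case
  proof (elim disjE bexE conjE)
    fix f' assume "f' \<in> Rt" "u = smult p f'" "smult a f = f' * v"
    then show ?thesis using mult(3)[OF mult(4) _ mult(6), of f'] p0 by auto
  next
    fix g' assume "g' \<in> Rt" "v = smult p g'" "smult a f = u * g'"
    then show ?thesis using mult(3)[OF mult(4,5), of g'] p0 by auto
  qed
qed

definition primitive :: "'k poly \<Rightarrow> bool" where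
  "primitive f \<longleftrightarrow> (\<forall>p. prime_in R p \<longrightarrow> \<not> divides_in Rt [:p:] f)"

text \<open>No prime of \<open>c\<close> divides the primitive \<open>f\<close>, so each must be
  absorbed by \<open>q\<close>. This turns divisibility over the field into divisibility in
  \<open>Rt\<close>.\<close>

lemma primitive_divides:
  assumes "prime_product R c" "f \<in> Rt" "primitive f" "a \<in> Rt" "q \<in> Rt" "smult c a = f * q"
  shows "divides_in Rt f a"
  using assms
proof (induction arbitrary: q rule: prime_product.induct)
  case (unit c)
  then obtain d where d: "d \<in> R" "d * c = 1" by (auto simp: unit_in_def mult.commute)
  then have "a = f * smult d q" using unit(6) by (metis mult_smult_right smult_1_left smult_smult)
  then show ?case using smult_mem[OF d(1) unit(5)] unfolding divides_in_def by blast
next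
  case (mult p b)
  have b: "b \<in> R" using mult(2) prime_product_mem by auto
  have "\<not> (\<exists>f'\<in>Rt. f = smult p f')" using mult(1,5) by (auto simp: primitive_def divides_in_def)
  then obtain q' where "q' \<in> Rt" "smult b a = f * q'"
    using prime_const_dividesD[OF mult(1,4,7,8) b mult(6)] by blast
  then show ?case using mult by blast
qed

lemma clear_denominators: "\<exists>c\<in>R. c \<noteq> 0 \<and> smult c f \<in> Rt"
proof (induction f rule: pCons_induct)
  case 0
  then show ?case using one_mem poly.zero_mem by (intro bexI[of _ 1]) auto
next
  case (pCons a f)
  then obtain c where c: "c \<in> R" "c \<noteq> 0" "smult c f \<in> Rt" by blast
  obtain b where b: "b \<in> R" "b \<noteq> 0" "b * a \<in> R" using frac[of a] by auto
  have "smult (b * c) (pCons a f) = pCons (c * (b * a)) (smult b (smult c f))"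
    by (simp add: ac_simps)
  also have "\<dots> \<in> Rt"
    using smult_mem[OF b(1) c(3)] mult_mem[OF c(1) b(3)]
      by (auto simp: polys_over_def coeff_pCons split: nat.split)
  finally show ?case using b c mult_mem[OF b(1) c(1)] by (intro bexI[of _ "b * c"]) auto
qed

text \<open>By \<open>gauss_factorization\<close> such an \<open>f\<close> stays irreducible over
  the field, where irreducible polynomials are prime; \<open>primitive_divides\<close> carries
  primality back to \<open>Rt\<close>.\<close>

lemma prime_in_primitive:
  assumes f: "f \<in> Rt" "Polynomial.degree f > 0" "primitive f"
    and irr: "\<And>u v. u \<in> Rt \<Longrightarrow> v \<in> Rt \<Longrightarrow> f = u * v \<Longrightarrow> Polynomial.degree u = 0 \<or> Polynomial.degree v = 0"
  shows "prime_in Rt f"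
proof -
  have f0: "f \<noteq> 0" using f by auto
  have "Factorial_Ring.irreducible f"
  proof (rule Factorial_Ring.irreducibleI)
    show "f \<noteq> 0" by fact
    show "\<not> f dvd 1" using f(2) by (auto simp: is_unit_poly_iff)
    fix a b assume ab: "f = a * b"
    obtain c d where c: "c \<in> R" "c \<noteq> 0" "smult c a \<in> Rt" and d: "d \<in> R" "d \<noteq> 0" "smult d b \<in> Rt"
      using clear_denominators by meson
    have "smult (c * d) f = smult c a * smult d b" using ab by (simp add: ac_simps)
    moreover have "prime_product R (c * d)" using c d mult_mem factorable by auto
    ultimately obtain u v where uv: "u \<in> Rt" "v \<in> Rt" "f = u * v"
      "Polynomial.degree u = Polynomial.degree (smult c a)"
        "Polynomial.degree v = Polynomial.degree (smult d b)"
      using gauss_factorization[OF _ f(1) c(3) d(3)] by blast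
    then have "Polynomial.degree a = 0 \<or> Polynomial.degree b = 0" using irr[OF uv(1-3)] c(2) d(2)
      by simp
    then show "a dvd 1 \<or> b dvd 1" using ab f0 by (auto simp: is_unit_iff_degree)
  qed
  then have prime: "prime_elem f" by (rule field_poly_irreducible_imp_prime)
  have main: "divides_in Rt f a" if dvd: "f dvd a" and a: "a \<in> Rt" for a
  proof -
    obtain q where q: "a = f * q" using dvd by (elim dvdE)
    obtain c where c: "c \<in> R" "c \<noteq> 0" "smult c q \<in> Rt" using clear_denominators by meson
    show ?thesis
      using primitive_divides[OF factorable[OF c(1,2)] f(1,3) a c(3)] q by simp
  qed
  have "\<not> unit_in Rt f" using f(2) by (auto simp: unit_in_poly_iff)
  moreover have "f dvd a \<or> f dvd b" if "divides_in Rt f (a * b)" for a b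
  proof -
    have "f dvd a * b" using that by (auto simp: divides_in_def)
    then show ?thesis using prime prime_elem_dvd_mult_iff by blast
  qed
  ultimately show ?thesis using f(1) f0 main unfolding prime_in_def by blast
qed

lemma content_split:
  assumes "prime_product R l" "f \<in> Rt"
    "\<And>c. c \<in> R \<Longrightarrow> c \<noteq> 0 \<Longrightarrow> divides_in Rt [:c:] f \<Longrightarrow> divides_in R c l"
  shows "\<exists>c\<in>R. \<exists>g\<in>Rt. f = smult c g \<and> primitive g"
  using assms
proof (induction arbitrary: f rule: prime_product.induct)
  case (unit u)
  have "primitive f"
    unfolding primitive_def
  proof (intro allI impI notI)
    fix p assume p: "prime_in R p" "divides_in Rt [:p:] f"
    then have "divides_in R p u" using unit(3) prime_in_mem prime_in_neq_0 by blast
    then show False using p unit(1) unit_in_multD by (auto simp: prime_in_def divides_in_def)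
  qed
  then show ?case using one_mem unit(2) by (metis smult_1_left)
next
  case (mult p a)
  have p: "p \<in> R" "p \<noteq> 0" using mult(1) prime_in_mem prime_in_neq_0 by auto
  have a: "a \<in> R" using mult(2) prime_product_mem by blast
  show ?case
  proof (cases "divides_in Rt [:p:] f")
    case True
    then obtain f' where f': "f' \<in> Rt" "f = [:p:] * f'" by (auto simp: divides_in_def)
    have "divides_in R c a" if c: "c \<in> R" "c \<noteq> 0" "divides_in Rt [:c:] f'" for c
    proof -
      obtain g where "g \<in> Rt" "f' = [:c:] * g" using c(3) by (auto simp: divides_in_def)
      then have "f = [:p * c:] * g" using f' by (simp add: mult.commute)
      then have "divides_in Rt [:p * c:] f" using \<open>g \<in> Rt\<close> unfolding divides_in_def by blast
      then have "divides_in R (p * c) (p * a)" using mult(5) c p mult_mem by auto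
      then show ?thesis using p(2) divides_in_mult_cancel by blast
    qed
    then obtain c g where g: "c \<in> R" "g \<in> Rt" "f' = smult c g" "primitive g"
      using mult(3)[OF f'(1)] by blast
    then have "f = smult (p * c) g" using f' by (simp add: mult.commute)
    then show ?thesis using g p mult_mem by blast
  next
    case False
    have "divides_in R c a" if c: "c \<in> R" "c \<noteq> 0" "divides_in Rt [:c:] f" for c
    proof -
      have "\<not> divides_in R p c"
      proof
        assume "divides_in R p c"
        then obtain d where "d \<in> R" "c = p * d" by (auto simp: divides_in_def)
        then have "divides_in Rt [:p:] [:c:]" using const_mem_iff unfolding divides_in_def
          by (intro bexI[of _ "[:d:]"]) auto
        then show False using c(3) False poly.divides_in_trans by blast
      qed
      moreover obtain e where e: "e \<in> R" "p * a = c * e" using mult(5)[OF c]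
        by (auto simp: divides_in_def)
      moreover have "divides_in R p (c * e)" using e(2) a by (metis divides_in_def)
      ultimately have "divides_in R p e" using prime_inD[OF mult(1)] c(1) by blast
      then obtain d where d: "d \<in> R" "e = p * d" by (auto simp: divides_in_def)
      then have "p * a = p * (c * d)" using e(2) by (simp add: ac_simps)
      then have "a = c * d" using p(2) by simp
      then show ?thesis using d(1) by (auto simp: divides_in_def)
    qed
    then show ?thesis using mult(3)[OF mult(4)] by blast
  qed
qed

text \<open>After the content is removed, the primitive part either splits into factors of smaller
  degree or is prime by \<open>prime_in_primitive\<close>.\<close>

lemma prime_product_poly: "f \<in> Rt \<Longrightarrow> f \<noteq> 0 \<Longrightarrow> prime_product Rt f"
proof (induction "Polynomial.degree f" arbitrary: f rule: less_induct)
  case less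
  show ?case
  proof (cases "Polynomial.degree f = 0")
    case True
    then obtain c where "f = [:c:]" by (metis degree_0_id)
    then show ?thesis using less prime_product_const factorable by (simp add: const_mem_iff)
  next
    case False
    have "Polynomial.coeff f (Polynomial.degree f) \<in> R" using less(2) by (simp add: polys_over_def)
    then have l: "prime_product R (lead_coeff f)" using less(3) factorable by simp
    have "divides_in R c (lead_coeff f)" if "c \<noteq> 0" "divides_in Rt [:c:] f" for c
      using that by (simp add: divides_in_const_iff)
    then obtain c g where g: "c \<in> R" "g \<in> Rt" "f = smult c g" "primitive g"
      using content_split[OF l less(2)] by blast
    then have c0: "c \<noteq> 0" and g0: "g \<noteq> 0" using less(3) by auto
    then have deg: "Polynomial.degree g = Polynomial.degree f" using g by simp
    have "prime_product Rt g"
    proof (cases "\<exists>u\<in>Rt. \<exists>v\<in>Rt. g = u * v \<and> Polynomial.degree u \<noteq> 0 \<and> Polynomial.degree v \<noteq> 0")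
      case True
      then obtain u v where uv: "u \<in> Rt" "v \<in> Rt" "g = u * v" "Polynomial.degree u \<noteq> 0"
        "Polynomial.degree v \<noteq> 0" by blast
      then have "u \<noteq> 0" "v \<noteq> 0" by auto
      then have "Polynomial.degree g = Polynomial.degree u + Polynomial.degree v"
        using uv(3) degree_mult_eq by blast
      then have "prime_product Rt u" "prime_product Rt v"
        using less(1)[of u] less(1)[of v] uv deg \<open>u \<noteq> 0\<close> \<open>v \<noteq> 0\<close> by auto
      then show ?thesis using uv(3) poly.prime_product_mult by simp
    next
      case irr: False
      have "prime_in Rt g" using prime_in_primitive[OF g(2) _ g(4)] irr False deg by auto
      then show ?thesis using prime_product.mult[OF _ prime_product.unit[OF poly.unit_in_one]]
        by fastforce
    qed
    moreover have "prime_product Rt [:c:]" using g(1) c0 factorable prime_product_const by blast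
    ultimately have "prime_product Rt ([:c:] * g)" using poly.prime_product_mult by blast
    then show ?thesis using g(3) by simp
  qed
qed

sublocale poly: ufd_subring Rt
  using prime_product_poly by unfold_locales

end

section \<open>The group law and reduction at a place\<close>

locale short_curve =
  fixes a2 a4 a6 :: "'a::field"
begin

abbreviation "W \<equiv> Weierstrass 0 a2 0 a4 a6"

definition on_curve :: "'a \<Rightarrow> 'a \<Rightarrow> bool" where
  "on_curve x y \<longleftrightarrow> y\<^sup>2 = x^3 + a2 * x\<^sup>2 + a4 * x + a6"

text \<open>The slope of the line through two points satisfies both equations, whether the points
  are distinct or not, and any one of them with a nonzero coefficient determines it.\<close>

definition is_slope :: "'a \<Rightarrow> 'a \<Rightarrow> 'a \<Rightarrow> 'a \<Rightarrow> 'a \<Rightarrow> bool" where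
  "is_slope x1 y1 x2 y2 l \<longleftrightarrow>
     l * (x2 - x1) = y2 - y1 \<and>
     l * (y1 + y2) = x1\<^sup>2 + x1 * x2 + x2\<^sup>2 + a2 * (x1 + x2) + a4"

definition third_x :: "'a \<Rightarrow> 'a \<Rightarrow> 'a \<Rightarrow> 'a" where
  "third_x x1 x2 l = l\<^sup>2 - a2 - x1 - x2"

definition third_y :: "'a \<Rightarrow> 'a \<Rightarrow> 'a \<Rightarrow> 'a \<Rightarrow> 'a" where
  "third_y x1 y1 x2 l = - (l * (third_x x1 x2 l - x1) + y1)"

lemma curve_points_iff: "Affine x y \<in> curve_points W \<longleftrightarrow> on_curve x y"
  by (auto simp: curve_points_def weierstrass_eqn_def on_curve_def)

lemma infinity_mem: "Infinity \<in> curve_points W"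
  by (simp add: curve_points_def)

text \<open>The difference of the two curve equations, factored: it makes the two equations in
  \<open>is_slope\<close> compatible.\<close>

lemma chord_eq:
  assumes "on_curve x1 y1" "on_curve x2 y2"
  shows "(y2 - y1) * (y1 + y2) = (x2 - x1) * (x1\<^sup>2 + x1 * x2 + x2\<^sup>2 + a2 * (x1 + x2) + a4)"
proof -
  have "(y2 - y1) * (y1 + y2) = y2\<^sup>2 - y1\<^sup>2" by (simp add: power2_eq_square algebra_simps)
  then show ?thesis using assms unfolding on_curve_def
    by (simp add: power2_eq_square power3_eq_cube algebra_simps)
qed

lemma ex_slope:
  assumes "on_curve x1 y1" "on_curve x2 y2" "\<not> (x1 = x2 \<and> y1 + y2 = 0)"
  shows "\<exists>l. is_slope x1 y1 x2 y2 l"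
proof (cases "x1 = x2")
  case False
  define l where "l = (y2 - y1) / (x2 - x1)"
  have 1: "l * (x2 - x1) = y2 - y1" using False by (simp add: l_def)
  have "(x2 - x1) * (l * (y1 + y2)) = (y2 - y1) * (y1 + y2)" using 1 by (simp add: ac_simps)
  also note chord_eq[OF assms(1,2)]
  finally show ?thesis using 1 False unfolding is_slope_def by auto
next
  case True
  then have "y1 + y2 \<noteq> 0" using assms(3) by simp
  moreover have "(y2 - y1) * (y1 + y2) = 0" using chord_eq[OF assms(1,2)] True by simp
  ultimately have "y2 = y1" "y1 + y2 \<noteq> 0" by auto
  then show ?thesis using True unfolding is_slope_def
    by (intro exI[of _ "(x1\<^sup>2 + x1 * x2 + x2\<^sup>2 + a2 * (x1 + x2) + a4) / (y1 + y2)"]) simp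
qed

lemma point_add_slope:
  assumes "is_slope x1 y1 x2 y2 l" "\<not> (x1 = x2 \<and> y1 + y2 = 0)"
  shows "point_add W (Affine x1 y1) (Affine x2 y2) = Affine (third_x x1 x2 l) (third_y x1 y1 x2 l)"
proof -
  have "l = (if x1 = x2 then (3 * x1\<^sup>2 + 2 * a2 * x1 + a4) / (2 * y1) else (y2 - y1) / (x2 - x1))"
  proof (cases "x1 = x2")
    case True
    then have "y1 = y2" "y1 + y2 \<noteq> 0" using assms by (auto simp: is_slope_def)
    then have "2 * y1 \<noteq> 0" "l * (2 * y1) = 3 * x1\<^sup>2 + 2 * a2 * x1 + a4"
      using assms(1) True by (auto simp: is_slope_def power2_eq_square mult_2 algebra_simps)
    then show ?thesis using True by (simp add: eq_divide_eq)
  qed (use assms in \<open>auto simp: is_slope_def eq_divide_eq\<close>)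
  then show ?thesis using assms(2) by (simp add: Let_def third_x_def third_y_def)
qed

lemma point_add_opposite: "y1 + y2 = 0 \<Longrightarrow> point_add W (Affine x y1) (Affine x y2) = Infinity"
  by simp

declare point_add.simps(3) [simp del]

lemma is_slope_commute: "is_slope x1 y1 x2 y2 l \<longleftrightarrow> is_slope x2 y2 x1 y1 l"
  unfolding is_slope_def by (auto simp: algebra_simps)

lemma third_commute:
  assumes "is_slope x1 y1 x2 y2 l"
  shows "third_x x2 x1 l = third_x x1 x2 l" "third_y x2 y2 x1 l = third_y x1 y1 x2 l"
proof -
  show x: "third_x x2 x1 l = third_x x1 x2 l" by (simp add: third_x_def)
  have "l * (x2 - x1) = y2 - y1" using assms by (simp add: is_slope_def)
  then show "third_y x2 y2 x1 l = third_y x1 y1 x2 l"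
    unfolding third_y_def x by (simp add: algebra_simps)
qed

lemma point_add_commute:
  assumes "P \<in> curve_points W" "Q \<in> curve_points W"
  shows "point_add W P Q = point_add W Q P"
proof (cases P; cases Q)
  fix x1 y1 x2 y2 assume PQ: "P = Affine x1 y1" "Q = Affine x2 y2"
  show ?thesis
  proof (cases "x1 = x2 \<and> y1 + y2 = 0")
    case False
    then obtain l where "is_slope x1 y1 x2 y2 l"
      using ex_slope assms PQ curve_points_iff by blast
    then show ?thesis
      using False PQ point_add_slope third_commute is_slope_commute by (metis add.commute)
  qed (use PQ in \<open>auto simp: point_add_opposite add.commute\<close>)
qed auto

text \<open>Eliminating \<open>y2\<close> turns the second slope equation into \<open>N\<close>,
  which no longer separates chord from tangent. With \<open>l^2\<close> expressed by the sum of the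
  abscissas, the rest is a polynomial identity.\<close>

lemma third_on_curve:
  assumes "on_curve x1 y1" "is_slope x1 y1 x2 y2 l"
  shows "on_curve (third_x x1 x2 l) (third_y x1 y1 x2 l)"
proof -
  define x3 where "x3 = third_x x1 x2 l"
  have l2: "l\<^sup>2 = x3 + a2 + x1 + x2" by (simp add: x3_def third_x_def)
  have s: "l * (x2 - x1) = y2 - y1" "l * (y1 + y2) = x1\<^sup>2 + x1 * x2 + x2\<^sup>2 + a2 * (x1 + x2) + a4"
    using assms(2) by (auto simp: is_slope_def)
  have y2: "y2 = y1 + l * (x2 - x1)" using s(1) by simp
  have "l * (y1 + y2) = 2 * l * y1 + l\<^sup>2 * (x2 - x1)"
    unfolding y2 by (simp add: power2_eq_square algebra_simps)
  then have N: "2 * l * y1 + l\<^sup>2 * (x2 - x1) = x1\<^sup>2 + x1 * x2 + x2\<^sup>2 + a2 * (x1 + x2) + a4"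
    using s(2) by simp
  have "(l * (x3 - x1) + y1)\<^sup>2 =
    (x3 - x1) * (2 * l * y1 + l\<^sup>2 * (x2 - x1)) + l\<^sup>2 * (x3 - x1) * (x3 - x2) + y1\<^sup>2"
    by (simp add: power2_eq_square algebra_simps)
  also have "\<dots> = x3^3 + a2 * x3\<^sup>2 + a4 * x3 + a6"
    using assms(1) unfolding N unfolding l2 on_curve_def
    by (simp add: power2_eq_square power3_eq_cube algebra_simps)
  finally show ?thesis
    unfolding on_curve_def third_y_def x3_def[symmetric] by (simp only: power2_minus)
qed

lemma point_add_closed:
  assumes "P \<in> curve_points W" "Q \<in> curve_points W"
  shows "point_add W P Q \<in> curve_points W"
proof (cases P; cases Q)
  fix x1 y1 x2 y2 assume PQ: "P = Affine x1 y1" "Q = Affine x2 y2"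
  show ?thesis
  proof (cases "x1 = x2 \<and> y1 + y2 = 0")
    case False
    then obtain l where l: "is_slope x1 y1 x2 y2 l"
      using ex_slope assms PQ curve_points_iff by blast
    then show ?thesis
      using False PQ point_add_slope[OF l] third_on_curve[OF _ l] assms(1) curve_points_iff by simp
  qed (use PQ infinity_mem in \<open>auto simp: point_add_opposite\<close>)
qed (use assms in \<open>auto simp: curve_points_def\<close>)

text \<open>The instance \<open>(P + Q) - Q = P\<close> of associativity: the same line, reflected,
  has slope \<open>- l\<close>. It serves the sum of two points that both reduce to
  infinity.\<close>

lemma point_add_cancel:
  assumes l: "is_slope x1 y1 x2 y2 l" and ne: "third_x x1 x2 l \<noteq> x2"
  shows "point_add W (Affine (third_x x1 x2 l) (third_y x1 y1 x2 l)) (Affine x2 (- y2)) =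
    Affine x1 y1"
proof -
  define x3 y3 where "x3 = third_x x1 x2 l" and "y3 = third_y x1 y1 x2 l"
  have l2: "l\<^sup>2 = x3 + a2 + x1 + x2" by (simp add: x3_def third_x_def)
  have s: "l * (x2 - x1) = y2 - y1" "l * (y1 + y2) = x1\<^sup>2 + x1 * x2 + x2\<^sup>2 + a2 * (x1 + x2) + a4"
    using l by (auto simp: is_slope_def)
  have y2: "y2 = y1 + l * (x2 - x1)" using s(1) by simp
  have "l * (y1 + y2) = 2 * l * y1 + l\<^sup>2 * (x2 - x1)"
    unfolding y2 by (simp add: power2_eq_square algebra_simps)
  then have N: "2 * l * y1 + l\<^sup>2 * (x2 - x1) = x1\<^sup>2 + x1 * x2 + x2\<^sup>2 + a2 * (x1 + x2) + a4"
    using s(2) by simp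
  have y3: "y3 = - (l * (x3 - x1) + y1)" by (simp add: y3_def third_y_def x3_def)
  have "- l * (y3 + - y2) = (2 * l * y1 + l\<^sup>2 * (x2 - x1)) + l\<^sup>2 * (x3 - x1)"
    unfolding y3 y2 by (simp add: power2_eq_square algebra_simps)
  also have "\<dots> = x3\<^sup>2 + x3 * x2 + x2\<^sup>2 + a2 * (x3 + x2) + a4"
    unfolding N unfolding l2 by (simp add: power2_eq_square algebra_simps)
  finally have N': "- l * (y3 + - y2) = x3\<^sup>2 + x3 * x2 + x2\<^sup>2 + a2 * (x3 + x2) + a4" .
  have "- l * (x2 - x3) = - y2 - y3" unfolding y3 y2 by (simp add: algebra_simps)
  then have slope: "is_slope x3 y3 x2 (- y2) (- l)"
    unfolding is_slope_def using N' by (rule conjI)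
  have x: "third_x x3 x2 (- l) = x1" by (simp add: third_x_def l2)
  have "third_y x3 y3 x2 (- l) = y1" unfolding third_y_def x y3 by (simp add: algebra_simps)
  then show ?thesis
    using point_add_slope[OF slope] ne x unfolding x3_def y3_def by simp
qed

end

text \<open>\<open>reg\<close> is a valuation ring and \<open>ev\<close> its residue map: the last
  two axioms put the inverse of every nonmember into the kernel of \<open>ev\<close>.\<close>

locale place =
  fixes reg :: "'a::field \<Rightarrow> bool" and ev :: "'a \<Rightarrow> 'b::field"
  assumes reg_one: "reg 1" and ev_one: "ev 1 = 1"
    and reg_diff: "reg x \<Longrightarrow> reg y \<Longrightarrow> reg (x - y)"
    and ev_diff: "reg x \<Longrightarrow> reg y \<Longrightarrow> ev (x - y) = ev x - ev y"
    and reg_mult: "reg x \<Longrightarrow> reg y \<Longrightarrow> reg (x * y)"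
    and ev_mult: "reg x \<Longrightarrow> reg y \<Longrightarrow> ev (x * y) = ev x * ev y"
    and reg_inverse_pole: "\<not> reg x \<Longrightarrow> reg (inverse x)"
    and ev_inverse_pole: "\<not> reg x \<Longrightarrow> ev (inverse x) = 0"
begin

lemma reg_zero: "reg 0" and ev_zero: "ev 0 = 0"
  using reg_diff[OF reg_one reg_one] ev_diff[OF reg_one reg_one] by simp_all

lemma reg_uminus: "reg x \<Longrightarrow> reg (- x)" and ev_uminus: "reg x \<Longrightarrow> ev (- x) = - ev x"
  using reg_diff[OF reg_zero, of x] ev_diff[OF reg_zero, of x] by (simp_all add: ev_zero)

lemma reg_add: "reg x \<Longrightarrow> reg y \<Longrightarrow> reg (x + y)"
  using reg_diff[of x "- y"] reg_uminus by simp

lemma ev_add: "reg x \<Longrightarrow> reg y \<Longrightarrow> ev (x + y) = ev x + ev y"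
  using ev_diff[of x "- y"] reg_uminus ev_uminus by simp

lemma reg_power: "reg x \<Longrightarrow> reg (x ^ n)" and ev_power: "reg x \<Longrightarrow> ev (x ^ n) = ev x ^ n"
proof -
  assume "reg x"
  then have "reg (x ^ n) \<and> ev (x ^ n) = ev x ^ n"
    by (induction n) (simp_all add: reg_one ev_one reg_mult ev_mult)
  then show "reg (x ^ n)" "ev (x ^ n) = ev x ^ n" by simp_all
qed

lemma reg_of_nat: "reg (of_nat n)" and ev_of_nat: "ev (of_nat n) = of_nat n"
proof -
  have "reg (of_nat n) \<and> ev (of_nat n) = of_nat n"
    by (induction n) (simp_all add: reg_zero ev_zero reg_one ev_one reg_add ev_add)
  then show "reg (of_nat n)" "ev (of_nat n) = of_nat n" by simp_all
qed

lemma reg_numeral: "reg (numeral n)" and ev_numeral: "ev (numeral n) = numeral n"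
  using reg_of_nat[of "numeral n"] ev_of_nat[of "numeral n"] by simp_all

text \<open>If \<open>inverse x\<close> had a pole, then \<open>x\<close>, being its inverse, would
  have value 0.\<close>

lemma reg_inverse: "reg x \<Longrightarrow> ev x \<noteq> 0 \<Longrightarrow> reg (inverse x)"
  using ev_inverse_pole[of "inverse x"] by auto

lemma ev_inverse:
  assumes "reg x" "ev x \<noteq> 0"
  shows "ev (inverse x) = inverse (ev x)"
proof -
  have "x \<noteq> 0" using assms ev_zero by auto
  then have "ev x * ev (inverse x) = 1"
    using ev_mult[OF assms(1) reg_inverse[OF assms]] ev_one by simp
  then show ?thesis using assms(2) by (simp add: field_simps)
qed

lemma reg_divide: "reg x \<Longrightarrow> reg y \<Longrightarrow> ev y \<noteq> 0 \<Longrightarrow> reg (x / y)"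
  unfolding divide_inverse by (intro reg_mult reg_inverse)

lemma ev_divide: "reg x \<Longrightarrow> reg y \<Longrightarrow> ev y \<noteq> 0 \<Longrightarrow> ev (x / y) = ev x / ev y"
  unfolding divide_inverse by (simp add: ev_mult ev_inverse reg_inverse)

text \<open>If \<open>x\<close> had a pole, evaluating \<open>1 = x ^ n * inverse x ^ n\<close>
  would give 0. It yields regularity of square roots throughout.\<close>

lemma reg_power_iff:
  assumes "n > 0"
  shows "reg (x ^ n) \<longleftrightarrow> reg x"
proof
  assume n: "reg (x ^ n)"
  show "reg x"
  proof (rule ccontr)
    assume x: "\<not> reg x"
    then have "x \<noteq> 0" using reg_zero by auto
    then have "1 = x ^ n * inverse x ^ n" by (simp add: power_inverse)
    then have "ev 1 = ev (x ^ n) * ev (inverse x) ^ n"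
      using n x reg_inverse_pole ev_mult reg_power ev_power by metis
    then show False using assms x by (simp add: ev_one ev_inverse_pole zero_power)
  qed
qed (rule reg_power)

lemmas reg_rules = reg_zero reg_one reg_numeral reg_uminus reg_add reg_diff reg_mult reg_power
lemmas ev_rules = ev_zero ev_one ev_numeral ev_uminus ev_add ev_diff ev_mult ev_power

fun reduce :: "'a point \<Rightarrow> 'b point" where
  "reduce Infinity = Infinity"
| "reduce (Affine x y) = (if reg x \<and> reg y then Affine (ev x) (ev y) else Infinity)"

end

text \<open>As 2 is nonzero in the residue field, a singular affine point has \<open>y = 0\<close>
  and a multiple root of the cubic as abscissa; \<open>nonsingular\<close> excludes exactly
  these.\<close>

locale good_reduction = place reg ev + short_curve a2 a4 a6
  for reg :: "'a::field \<Rightarrow> bool" and ev :: "'a \<Rightarrow> 'b::field" and a2 a4 a6 :: 'a +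
  assumes reg_coeffs: "reg a2" "reg a4" "reg a6"
    and nonsingular: "\<And>x. x^3 + ev a2 * x\<^sup>2 + ev a4 * x + ev a6 = 0 \<Longrightarrow>
      3 * x\<^sup>2 + 2 * ev a2 * x + ev a4 \<noteq> 0"
    and two_neq_zero: "(2::'b) \<noteq> 0"
begin

sublocale red: short_curve "ev a2" "ev a4" "ev a6" .

lemma reg_y:
  assumes "on_curve x y" "reg x"
  shows "reg y"
proof -
  have "reg (y\<^sup>2)" using assms reg_coeffs by (simp add: on_curve_def reg_rules)
  then show ?thesis by (simp add: reg_power_iff)
qed

lemma reduce_affine:
  "on_curve x y \<Longrightarrow> reduce (Affine x y) = (if reg x then Affine (ev x) (ev y) else Infinity)"
  using reg_y by auto

lemma red_on_curve:
  assumes "on_curve x y" "reg x"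
  shows "red.on_curve (ev x) (ev y)"
proof -
  have "ev (y\<^sup>2) = ev (x^3 + a2 * x\<^sup>2 + a4 * x + a6)" using assms(1) by (simp add: on_curve_def)
  then show ?thesis using assms reg_y reg_coeffs
    by (simp add: red.on_curve_def reg_rules ev_rules)
qed

lemma reduce_closed: "P \<in> curve_points W \<Longrightarrow> reduce P \<in> curve_points red.W"
  by (cases P) (use red_on_curve in \<open>auto simp: curve_points_iff red.curve_points_iff infinity_mem
    red.infinity_mem\<close>)

lemma red_is_slope:
  assumes "is_slope x1 y1 x2 y2 l" "reg x1" "reg y1" "reg x2" "reg y2" "reg l"
  shows "red.is_slope (ev x1) (ev y1) (ev x2) (ev y2) (ev l)"
proof -
  have "ev (l * (x2 - x1)) = ev (y2 - y1)"
    "ev (l * (y1 + y2)) = ev (x1\<^sup>2 + x1 * x2 + x2\<^sup>2 + a2 * (x1 + x2) + a4)"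
    using assms(1) by (simp_all add: is_slope_def)
  then show ?thesis using assms(2-) reg_coeffs
    by (simp add: red.is_slope_def reg_rules ev_rules)
qed

text \<open>If the sum is affine, its slope is regular exactly when the reduced points are not
  opposite.\<close>

lemma reduce_add_regular:
  assumes c: "on_curve x1 y1" "on_curve x2 y2" and r: "reg x1" "reg x2"
  shows "reduce (point_add W (Affine x1 y1) (Affine x2 y2)) =
    point_add red.W (Affine (ev x1) (ev y1)) (Affine (ev x2) (ev y2))"
proof (cases "x1 = x2 \<and> y1 + y2 = 0")
  case True
  have "ev y1 + ev y2 = ev (y1 + y2)" using c r reg_y ev_add by metis
  then show ?thesis using True by (simp add: point_add_opposite red.point_add_opposite ev_zero)
next
  case False
  then obtain l where l: "is_slope x1 y1 x2 y2 l" using ex_slope c by blast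
  have y: "reg y1" "reg y2" using c r reg_y by blast+
  have sum: "point_add W (Affine x1 y1) (Affine x2 y2) =
    Affine (third_x x1 x2 l) (third_y x1 y1 x2 l)"
    using point_add_slope[OF l False] .
  show ?thesis
  proof (cases "ev x1 = ev x2 \<and> ev y1 + ev y2 = 0")
    case True
    \<comment> \<open>A regular slope would reduce to a slope through opposite points of equal
      ordinate: the ordinate is then 0 and the derivative of the cubic vanishes, a singular
      point.\<close>
    have "\<not> reg l"
    proof
      assume reg: "reg l"
      note s = red_is_slope[OF l r(1) y(1) r(2) y(2) reg]
      then have "ev y2 = ev y1" using True by (simp add: red.is_slope_def)
      then have "2 * ev y1 = 0" using True by (metis mult_2)
      then have "ev y1 = 0" using two_neq_zero by simp
      then have "ev x1 ^ 3 + ev a2 * (ev x1)\<^sup>2 + ev a4 * ev x1 + ev a6 = 0"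
        using red_on_curve[OF c(1) r(1)] by (simp add: red.on_curve_def)
      then have "3 * (ev x1)\<^sup>2 + 2 * ev a2 * ev x1 + ev a4 \<noteq> 0" by (rule nonsingular)
      moreover have "3 * (ev x1)\<^sup>2 + 2 * ev a2 * ev x1 + ev a4 = 0"
        using s True by (simp add: red.is_slope_def power2_eq_square algebra_simps)
      ultimately show False by simp
    qed
    then have "\<not> reg (l\<^sup>2)" by (simp add: reg_power_iff)
    moreover have "l\<^sup>2 = third_x x1 x2 l + a2 + x1 + x2" by (simp add: third_x_def)
    ultimately have "\<not> reg (third_x x1 x2 l)" using r reg_coeffs reg_add by metis
    then show ?thesis using True unfolding sum by (simp add: red.point_add_opposite)
  next
    case notneg: False
    \<comment> \<open>Whichever slope equation keeps a nonzero coefficient after reduction writes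
      \<open>l\<close> as a regular quotient.\<close>
    have reg: "reg l"
    proof (cases "ev x1 = ev x2")
      case True
      then have "ev (y1 + y2) \<noteq> 0" using notneg y by (simp add: ev_add)
      moreover from this have "y1 + y2 \<noteq> 0" by (auto simp: ev_zero)
      moreover have "l = (x1\<^sup>2 + x1 * x2 + x2\<^sup>2 + a2 * (x1 + x2) + a4) / (y1 + y2)"
        using l \<open>y1 + y2 \<noteq> 0\<close> by (simp add: is_slope_def eq_divide_eq)
      ultimately show ?thesis using r y reg_coeffs by (simp add: reg_divide reg_rules)
    next
      case ne: False
      then have "l = (y2 - y1) / (x2 - x1)" "ev (x2 - x1) \<noteq> 0"
        using l r by (auto simp: is_slope_def eq_divide_eq ev_diff)
      then show ?thesis using r y by (simp add: reg_divide reg_diff)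
    qed
    note s = red_is_slope[OF l r(1) y(1) r(2) y(2) reg]
    have "reg (third_x x1 x2 l)" "ev (third_x x1 x2 l) = red.third_x (ev x1) (ev x2) (ev l)"
      using reg r reg_coeffs unfolding third_x_def red.third_x_def
        by (simp_all add: reg_rules ev_rules)
    moreover from this have "reg (third_y x1 y1 x2 l)"
      "ev (third_y x1 y1 x2 l) = red.third_y (ev x1) (ev y1) (ev x2) (ev l)"
      using reg r y unfolding third_y_def red.third_y_def by (simp_all add: reg_rules ev_rules)
    ultimately show ?thesis unfolding sum red.point_add_slope[OF s notneg] by simp
  qed
qed

text \<open>With \<open>w = 1 / x1\<close> and \<open>q = y1 w\<^sup>2\<close>, which vanish under reduction, both coordinates of the sum
  become quotients of regular elements.\<close>

lemma reduce_add_pole: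
  assumes c: "on_curve x1 y1" "on_curve x2 y2" and r: "\<not> reg x1" "reg x2"
  shows "reduce (point_add W (Affine x1 y1) (Affine x2 y2)) = Affine (ev x2) (ev y2)"
proof -
  have ne: "x1 \<noteq> x2" using r by auto
  then obtain l where l: "is_slope x1 y1 x2 y2 l" using ex_slope c by blast
  have y2: "reg y2" using c r reg_y by blast
  define w q where "w = inverse x1" and "q = y1 * w\<^sup>2"
  have x1: "x1 \<noteq> 0" using r(1) reg_zero by auto
  then have xw: "x1 * w = 1" "w \<noteq> 0" by (auto simp: w_def)
  have w: "reg w" "ev w = 0" using r(1) by (simp_all add: w_def reg_inverse_pole ev_inverse_pole)
  \<comment> \<open>\<open>u\<close> is the right side of the curve equation divided by
    \<open>x1^3\<close>; so \<open>y1^2 * w^3\<close> has value 1, and \<open>q^2 = w * u\<close>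
    forces \<open>q\<close> to vanish.\<close>
  define u where "u = 1 + a2 * w + a4 * w\<^sup>2 + a6 * w^3"
  have u: "reg u" "ev u = 1" using w reg_coeffs by (simp_all add: u_def reg_rules ev_rules)
  have "y1\<^sup>2 * w^3 = (x1 * w)^3 + a2 * w * (x1 * w)\<^sup>2 + a4 * w\<^sup>2 * (x1 * w) + a6 * w^3"
    using c(1) by (simp add: on_curve_def power2_eq_square power3_eq_cube algebra_simps)
  then have yu: "y1\<^sup>2 * w^3 = u" using xw by (simp add: u_def)
  have "q\<^sup>2 = w * (y1\<^sup>2 * w^3)" by (simp add: q_def power2_eq_square power3_eq_cube ac_simps)
  then have q2: "q\<^sup>2 = w * u" using yu by simp
  then have "reg (q\<^sup>2)" using w u by (simp add: reg_mult)
  then have q: "reg q" by (simp add: reg_power_iff)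
  have "ev (q\<^sup>2) = 0" using q2 w u by (simp add: ev_mult)
  then have q0: "ev q = 0" using q by (simp add: ev_power)
  \<comment> \<open>\<open>d\<close> is \<open>(x1 - x2) / x1\<close>, the denominator of the slope
    made regular.\<close>
  define d where "d = 1 - x2 * w"
  have d: "reg d" "ev d = 1" using w r(2) by (simp_all add: d_def reg_rules ev_rules)
  then have d0: "d \<noteq> 0" using ev_zero by auto
  have xd: "(x1 - x2) * w = d" using xw by (simp add: d_def left_diff_distrib)
  define x3 where "x3 = third_x x1 x2 l"
  have lx: "l * (x2 - x1) = y2 - y1" using l by (simp add: is_slope_def)
  have "l * d = l * (x1 - x2) * w" unfolding xd[symmetric] by (simp add: ac_simps)
  also have "l * (x1 - x2) = y1 - y2" using lx by (simp add: algebra_simps)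
  finally have ld: "l * d = (y1 - y2) * w" .
  \<comment> \<open>In \<open>x3 - x2\<close> the terms with \<open>x1^3\<close> and
    \<open>x1^2\<close> cancel by the curve equations. What remains is linear in \<open>x1\<close>
    and in \<open>y1\<close>, and the factor \<open>w^2\<close> gives it value 0.\<close>
  have "(x3 - x2) * d\<^sup>2 = (l * d)\<^sup>2 - (a2 + x1 + 2 * x2) * d\<^sup>2"
    unfolding x3_def third_x_def by (simp add: power2_eq_square algebra_simps)
  also have "\<dots> = ((y1 - y2)\<^sup>2 - (a2 + x1 + 2 * x2) * (x1 - x2)\<^sup>2) * w\<^sup>2"
    unfolding ld unfolding xd[symmetric] by (simp add: power2_eq_square algebra_simps)
  also have "(y1 - y2)\<^sup>2 - (a2 + x1 + 2 * x2) * (x1 - x2)\<^sup>2 =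
    3 * x1 * x2\<^sup>2 - x2^3 + a4 * (x1 + x2) + 2 * a6 + 2 * a2 * x1 * x2 - 2 * y1 * y2"
    using c unfolding on_curve_def power2_diff
      by (simp add: power2_eq_square power3_eq_cube algebra_simps)
  finally have A: "(x3 - x2) * d\<^sup>2 =
    (3 * x1 * x2\<^sup>2 - x2^3 + a4 * (x1 + x2) + 2 * a6 + 2 * a2 * x1 * x2 - 2 * y1 * y2) * w\<^sup>2" .
  define m where "m = 3 * x2\<^sup>2 - x2^3 * w + a4 * (1 + x2 * w) + 2 * a6 * w + 2 * a2 * x2"
  have m: "reg m" using w r(2) reg_coeffs by (simp add: m_def reg_rules)
  have "(3 * x1 * x2\<^sup>2 - x2^3 + a4 * (x1 + x2) + 2 * a6 + 2 * a2 * x1 * x2) * w =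
    3 * (x1 * w) * x2\<^sup>2 - x2^3 * w + a4 * (x1 * w + x2 * w) + 2 * a6 * w + 2 * a2 * (x1 * w) * x2"
    by (simp add: algebra_simps)
  then have mw: "(3 * x1 * x2\<^sup>2 - x2^3 + a4 * (x1 + x2) + 2 * a6 + 2 * a2 * x1 * x2) * w = m"
    unfolding xw m_def by simp
  have B: "(x3 - x2) * d\<^sup>2 = m * w - 2 * q * y2"
    unfolding A mw[symmetric] q_def by (simp add: power2_eq_square algebra_simps)
  then have x3: "x3 = x2 + (m * w - 2 * q * y2) / d\<^sup>2" using d0 by (simp add: field_simps)
  have d2: "reg (d\<^sup>2)" "ev (d\<^sup>2) = 1" using d by (simp_all add: reg_power ev_power)
  have n: "reg (m * w - 2 * q * y2)" "ev (m * w - 2 * q * y2) = 0"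
    using m w q y2 q0 by (simp_all add: reg_rules ev_rules)
  have "reg ((m * w - 2 * q * y2) / d\<^sup>2)" "ev ((m * w - 2 * q * y2) / d\<^sup>2) = 0"
    using d2 n reg_divide[OF n(1) d2(1)] ev_divide[OF n(1) d2(1)] by simp_all
  then have rx3: "reg x3" "ev x3 = ev x2"
    unfolding x3 using r(2) by (simp_all add: reg_add ev_add)
  \<comment> \<open>The parts of \<open>l * d\<close> and of \<open>x3 - x2\<close> that are linear
    in \<open>y1\<close> multiply to \<open>- 2 * u * y2\<close>, of value
    \<open>- 2 * ev y2\<close>; this makes \<open>- (l * (x3 - x2)) - y2\<close> reduce to
    \<open>ev y2\<close>.\<close>
  have "l * (x3 - x2) * d^3 = (l * d) * ((x3 - x2) * d\<^sup>2)"
    by (simp add: power2_eq_square power3_eq_cube)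
  also have "\<dots> = m * (y1 * w\<^sup>2) - 2 * (y1\<^sup>2 * w^3) * y2 - y2 * w * (m * w - 2 * q * y2)"
    unfolding ld B q_def by (simp add: power2_eq_square power3_eq_cube algebra_simps)
  also have "\<dots> = m * q - 2 * u * y2 - y2 * w * (m * w - 2 * q * y2)" unfolding yu q_def by simp
  finally have "l * (x3 - x2) = (m * q - 2 * u * y2 - y2 * w * (m * w - 2 * q * y2)) / d^3"
    using d0 by (simp add: eq_divide_eq)
  moreover have "reg (d^3)" "ev (d^3) = 1" using d by (simp_all add: reg_power ev_power)
  moreover have "reg (m * q - 2 * u * y2 - y2 * w * (m * w - 2 * q * y2))"
    "ev (m * q - 2 * u * y2 - y2 * w * (m * w - 2 * q * y2)) = - 2 * ev y2"
    using n m w q y2 q0 u by (simp_all add: reg_rules ev_rules)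
  ultimately have s: "reg (l * (x3 - x2))" "ev (l * (x3 - x2)) = - 2 * ev y2"
    by (simp_all add: reg_divide ev_divide)
  have "third_y x1 y1 x2 l = - (l * (x3 - x1) + y1)" by (simp add: third_y_def x3_def)
  also have "\<dots> = - (l * (x3 - x2)) - y2" using lx by (simp add: algebra_simps)
  finally have "reg (third_y x1 y1 x2 l)" "ev (third_y x1 y1 x2 l) = ev y2"
    using s y2 by (simp_all add: reg_rules ev_rules)
  moreover have "point_add W (Affine x1 y1) (Affine x2 y2) = Affine x3 (third_y x1 y1 x2 l)"
    using point_add_slope[OF l] ne unfolding x3_def by simp
  ultimately show ?thesis using rx3 by simp
qed

lemma reduce_add:
  assumes "P \<in> curve_points W" "Q \<in> curve_points W"
  shows "reduce (point_add W P Q) = point_add red.W (reduce P) (reduce Q)"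
proof (cases P; cases Q)
  fix x1 y1 x2 y2 assume PQ: "P = Affine x1 y1" "Q = Affine x2 y2"
  have c: "on_curve x1 y1" "on_curve x2 y2" using assms PQ curve_points_iff by auto
  consider "reg x1" "reg x2" | "\<not> reg x1" "reg x2" | "reg x1" "\<not> reg x2" | "\<not> reg x1" "\<not> reg x2"
    by blast
  then show ?thesis
  proof cases
    case 1
    then show ?thesis using reduce_add_regular[OF c] c PQ
      by (simp add: reduce_affine del: reduce.simps(2))
  next
    case 2
    then show ?thesis using reduce_add_pole[OF c] c PQ
      by (simp add: reduce_affine del: reduce.simps(2))
  next
    case 3
    then show ?thesis using reduce_add_pole[OF c(2,1)] c PQ point_add_commute[OF assms]
      by (simp add: reduce_affine del: reduce.simps(2))
  next
    case 4
    have "reduce (point_add W P Q) = Infinity"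
    proof (cases "x1 = x2 \<and> y1 + y2 = 0")
      case False
      then obtain l where l: "is_slope x1 y1 x2 y2 l" using ex_slope c by blast
      define x3 y3 where "x3 = third_x x1 x2 l" and "y3 = third_y x1 y1 x2 l"
      have sum: "point_add W P Q = Affine x3 y3"
        using point_add_slope[OF l False] PQ by (simp add: x3_def y3_def)
      have c3: "on_curve x3 y3" using third_on_curve[OF c(1) l] by (simp add: x3_def y3_def)
      have c2: "on_curve x2 (- y2)" using c(2) by (simp add: on_curve_def)
      \<comment> \<open>If the sum were regular, subtracting the second point, which reduces to
        infinity, would leave a regular point by \<open>reduce_add_pole\<close>; but the first point
        is not regular.\<close>
      have "\<not> reg x3"
      proof
        assume "reg x3"
        then have "x3 \<noteq> x2" using 4 by auto
        then have "point_add W (Affine x3 y3) (Affine x2 (- y2)) = Affine x1 y1"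
          using point_add_cancel[OF l] by (simp add: x3_def y3_def)
        then have "point_add W (Affine x2 (- y2)) (Affine x3 y3) = Affine x1 y1"
          using point_add_commute c2 c3 curve_points_iff by metis
        then show False
          using reduce_add_pole[OF c2 c3 4(2) \<open>reg x3\<close>] 4(1) by simp
      qed
      then show ?thesis using sum by simp
    qed (use PQ point_add_opposite in auto)
    then show ?thesis using 4 PQ by simp
  qed
qed auto

end

section \<open>Infinite descent by halving\<close>

locale ufd_of_field = ufd_subring A for A :: "'a::field set" +
  assumes frac: "\<exists>a\<in>A. \<exists>b\<in>A. b \<noteq> 0 \<and> x = a / b"
begin

lemma root_mem:
  assumes "z\<^sup>2 \<in> A"
  shows "z \<in> A"
proof -
  obtain a b where ab: "a \<in> A" "b \<in> A" "b \<noteq> 0" "z = a / b" using frac by blast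
  have "a\<^sup>2 = b\<^sup>2 * z\<^sup>2" using ab by (simp add: power_divide)
  then have "divides_in A (b\<^sup>2) (a\<^sup>2)" using assms unfolding divides_in_def by blast
  then have "divides_in A b a" using prime_product_root_closed[OF factorable[OF ab(2,3)] ab(1)]
    by blast
  then show ?thesis using ab by (auto simp: divides_in_def)
qed

lemma ex_sqfree_part:
  assumes "z \<noteq> 0"
  shows "\<exists>h\<in>A. \<exists>s. sqfree_in A h \<and> z = h * s\<^sup>2"
proof -
  obtain a b where ab: "a \<in> A" "b \<in> A" "b \<noteq> 0" "z = a / b" using frac by blast
  then have "a * b \<in> A" "a * b \<noteq> 0" using assms mult_mem by auto
  then obtain h s where h: "h \<in> A" "sqfree_in A h" "a * b = h * s\<^sup>2"
    using prime_product_sqfree_part[OF factorable] by blast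
  \<comment> \<open>Extending the fraction by \<open>b\<close> makes its denominator a
    square.\<close>
  have "z = a * b / b\<^sup>2" using ab by (simp add: power2_eq_square)
  then have "z = h * (s / b)\<^sup>2" using h(3) by (simp add: power_divide)
  then show ?thesis using h by blast
qed

text \<open>A relation rather than a function: the exponent is read off from any fraction prime to
  \<open>p\<close>, and for prime \<open>p\<close> zero has no valuation.\<close>

definition has_valuation :: "'a \<Rightarrow> int \<Rightarrow> 'a \<Rightarrow> bool" where
  "has_valuation p n z \<longleftrightarrow>
     (\<exists>a\<in>A. \<exists>b\<in>A. \<not> divides_in A p a \<and> \<not> divides_in A p b \<and> z = p powi n * (a / b))"

lemma divides_in_zero: "divides_in A p 0"
  unfolding divides_in_def using zero_mem by (metis mult_zero_right)

lemma prime_not_divides_mult: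
  "prime_in A p \<Longrightarrow> \<not> divides_in A p a \<Longrightarrow> \<not> divides_in A p b \<Longrightarrow> a \<in> A \<Longrightarrow> b \<in> A \<Longrightarrow>
    \<not> divides_in A p (a * b)"
  using prime_inD by blast

lemma prime_not_divides_unit:
  assumes "prime_in A p" "unit_in A u"
  shows "\<not> divides_in A p u"
proof
  assume "divides_in A p u"
  then obtain c where "c \<in> A" "u = p * c" by (auto simp: divides_in_def)
  then have "unit_in A p" using assms unit_in_multD prime_in_mem by blast
  then show False using assms(1) by (simp add: prime_in_def)
qed

lemma prime_divides_prime:
  assumes p: "prime_in A p" and q: "prime_in A q" and "divides_in A p q"
  shows "\<exists>u. unit_in A u \<and> q = p * u"
proof -
  obtain d where d: "d \<in> A" "q = p * d" using assms(3) by (auto simp: divides_in_def)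
  note nz = prime_in_neq_0[OF p] prime_in_neq_0[OF q]
  note mem = prime_in_mem[OF p] prime_in_mem[OF q]
  have "divides_in A q (p * d)" using d one_mem by (auto simp: divides_in_def)
  then consider "divides_in A q p" | "divides_in A q d" using prime_inD[OF q] mem d(1) by blast
  then have "unit_in A d"
  proof cases
    case 1
    then obtain c where c: "c \<in> A" "p = q * c" by (auto simp: divides_in_def)
    have "q * 1 = q * (d * c)" using c(2) d(2) by (metis mult.assoc mult.commute mult_1_right)
    then have "d * c = 1" using nz by simp
    then show ?thesis using d(1) c(1) by (auto simp: unit_in_def)
  next
    case 2
    then obtain c where c: "c \<in> A" "d = q * c" by (auto simp: divides_in_def)
    have "q * 1 = q * (p * c)" using c(2) d(2) by (metis mult.left_commute mult_1_right)
    then have "p * c = 1" using nz by simp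
    then have "unit_in A p" using mem c(1) by (auto simp: unit_in_def)
    then show ?thesis using p by (simp add: prime_in_def)
  qed
  then show ?thesis using d by blast
qed

lemma prime_power_split:
  assumes p: "prime_in A p"
  shows "prime_product A a \<Longrightarrow> \<exists>k. \<exists>c\<in>A. \<not> divides_in A p c \<and> a = p ^ k * c"
proof (induction rule: prime_product.induct)
  case (unit u)
  then show ?case using prime_not_divides_unit[OF p unit] unit_in_mem
    by (intro exI[of _ 0] bexI[of _ u]) auto
next
  case (mult q a)
  then obtain k c where c: "c \<in> A" "\<not> divides_in A p c" "a = p ^ k * c" by blast
  show ?case
  proof (cases "divides_in A p q")
    case True
    then obtain u where u: "unit_in A u" "q = p * u" using prime_divides_prime[OF p mult(1)]
      by blast
    then have "\<not> divides_in A p (u * c)" "u * c \<in> A"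
      using prime_not_divides_mult[OF p prime_not_divides_unit[OF p u(1)] c(2)] unit_in_mem c(1)
        mult_mem by auto
    moreover have "q * a = p ^ Suc k * (u * c)" using u c by simp
    ultimately show ?thesis by blast
  next
    case False
    then have "\<not> divides_in A p (q * c)" "q * c \<in> A"
      using prime_not_divides_mult[OF p False c(2)] prime_in_mem[OF mult(1)] c(1) mult_mem by auto
    moreover have "q * a = p ^ k * (q * c)" using c by simp
    ultimately show ?thesis by blast
  qed
qed

section \<open>The valuation at a prime of the factorial ring\<close>

context
  fixes p
  assumes p: "prime_in A p"
begin

lemma has_valuation_exists:
  assumes "z \<noteq> 0"
  shows "\<exists>n. has_valuation p n z"
proof -
  obtain a b where ab: "a \<in> A" "b \<in> A" "b \<noteq> 0" "z = a / b" using frac by blast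
  then have "a \<noteq> 0" using assms by auto
  then obtain k c l d where c: "c \<in> A" "\<not> divides_in A p c" "a = p ^ k * c"
    and d: "d \<in> A" "\<not> divides_in A p d" "b = p ^ l * d"
    using prime_power_split[OF p factorable[OF ab(1)]] prime_power_split[OF p factorable[OF
      ab(2,3)]] by metis
  have "z = p powi (int k - int l) * (c / d)"
    using ab c d prime_in_neq_0[OF p] by (simp add: power_int_diff)
  then show ?thesis unfolding has_valuation_def using c d by blast
qed

lemma has_valuation_mult:
  assumes "has_valuation p m z" "has_valuation p n w"
  shows "has_valuation p (m + n) (z * w)"
proof -
  obtain a b c d where *: "a \<in> A" "b \<in> A" "\<not> divides_in A p a" "\<not> divides_in A p b"
    "z = p powi m * (a / b)"
    "c \<in> A" "d \<in> A" "\<not> divides_in A p c" "\<not> divides_in A p d" "w = p powi n * (c / d)"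
    using assms unfolding has_valuation_def by metis
  have "z * w = p powi (m + n) * (a * c / (b * d))"
    using * prime_in_neq_0[OF p] by (simp add: power_int_add)
  then show ?thesis unfolding has_valuation_def using * mult_mem prime_not_divides_mult[OF p]
    by metis
qed

lemma has_valuation_add:
  assumes "has_valuation p m z" "has_valuation p n w" "m < n"
  shows "has_valuation p m (z + w)"
proof -
  obtain a b c d where *: "a \<in> A" "b \<in> A" "\<not> divides_in A p a" "\<not> divides_in A p b"
    "z = p powi m * (a / b)"
    "c \<in> A" "d \<in> A" "\<not> divides_in A p c" "\<not> divides_in A p d" "w = p powi n * (c / d)"
    using assms unfolding has_valuation_def by metis
  have nz: "b \<noteq> 0" "d \<noteq> 0" using * divides_in_zero by metis+
  \<comment> \<open>One factor \<open>p\<close> is split off from \<open>p powi (n - m)\<close>,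
    hence the 1: the second summand is visibly divisible by \<open>p\<close> and the first is
    not.\<close>
  define k where "k = nat (n - m) - 1"
  have n: "n = m + int (Suc k)" using assms(3) by (simp add: k_def)
  have w: "w = p powi m * (p ^ Suc k * (c / d))"
    unfolding *(10) n using prime_in_neq_0[OF p] by (simp add: power_int_add)
  have "z + w = p powi m * ((a * d + p * (p ^ k * c * b)) / (b * d))"
    unfolding *(5) w using nz by (simp add: field_simps)
  moreover have mem: "p ^ k * c * b \<in> A" using * prime_in_mem[OF p] mult_mem power_mem by simp
  moreover have "\<not> divides_in A p (a * d + p * (p ^ k * c * b))"
  proof
    assume "divides_in A p (a * d + p * (p ^ k * c * b))"
    moreover have "divides_in A p (p * (p ^ k * c * b))"
      unfolding divides_in_def using mem by blast
    ultimately have "divides_in A p (a * d)" using divides_in_diff by fastforce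
    then show False using prime_not_divides_mult[OF p *(3,9,1,7)] by blast
  qed
  moreover have "\<not> divides_in A p (b * d)" using prime_not_divides_mult[OF p *(4,9,2,7)] .
  moreover have "a * d + p * (p ^ k * c * b) \<in> A" "b * d \<in> A"
    using * prime_in_mem[OF p] mult_mem power_mem add_mem by simp_all
  ultimately show ?thesis unfolding has_valuation_def by blast
qed

lemma has_valuation_not_less:
  assumes "has_valuation p m z" "has_valuation p n z"
  shows "\<not> m < n"
proof
  assume less: "m < n"
  obtain a b c d where *: "a \<in> A" "b \<in> A" "\<not> divides_in A p a" "\<not> divides_in A p b"
    "z = p powi m * (a / b)"
    "c \<in> A" "d \<in> A" "\<not> divides_in A p c" "\<not> divides_in A p d" "z = p powi n * (c / d)"
    using assms unfolding has_valuation_def by metis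
  have nz: "b \<noteq> 0" "d \<noteq> 0" "p \<noteq> 0" using * divides_in_zero prime_in_neq_0[OF p] by metis+
  define k where "k = nat (n - m) - 1"
  have n: "n = m + int (Suc k)" using less by (simp add: k_def)
  have "p powi n = p powi m * p ^ Suc k" unfolding n using nz
    by (simp only: power_int_add power_int_of_nat simp_thms)
  then have "p powi m * (a / b) = p powi m * (p ^ Suc k * (c / d))"
    using *(5,10) by (metis mult.assoc)
  moreover have "p powi m \<noteq> 0" using nz by simp
  ultimately have "a / b = p ^ Suc k * (c / d)" using mult_left_cancel by blast
  then have "a * d = p * (p ^ k * c * b)" using nz by (simp add: field_simps)
  moreover have "p ^ k * c * b \<in> A" using * prime_in_mem[OF p] mult_mem power_mem by simp
  ultimately have "divides_in A p (a * d)" unfolding divides_in_def by blast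
  then show False using prime_not_divides_mult[OF p *(3,9,1,7)] by blast
qed

lemma has_valuation_unique: "has_valuation p m z \<Longrightarrow> has_valuation p n z \<Longrightarrow> m = n"
  using has_valuation_not_less by (meson linorder_neqE)

lemma has_valuation_0: "a \<in> A \<Longrightarrow> \<not> divides_in A p a \<Longrightarrow> has_valuation p 0 a"
  unfolding has_valuation_def using one_mem prime_not_divides_unit[OF p unit_in_one]
  by (intro bexI[of _ a] bexI[of _ 1]) auto

lemma has_valuation_1: "has_valuation p 1 p"
  unfolding has_valuation_def using one_mem prime_not_divides_unit[OF p unit_in_one]
  by (intro bexI[of _ 1]) auto

text \<open>If \<open>p\<close> divides neither difference, the valuation of \<open>z (z + d) (z + d')\<close> is that of \<open>z\<close> when
  it is
  positive and three times that of \<open>z\<close> when it is negative.\<close>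

lemma odd_valuation_divides:
  assumes n: "has_valuation p n z" "odd n"
    and sq: "z * (z + d) * (z + d') = y\<^sup>2" "y \<noteq> 0" and d: "d \<in> A" "d' \<in> A"
  shows "divides_in A p (d * d')"
proof (rule ccontr)
  assume ndvd: "\<not> divides_in A p (d * d')"
  then have "\<not> divides_in A p d" "\<not> divides_in A p d'"
    using divides_in_mult d by (metis, metis mult.commute)
  then have v: "has_valuation p 0 d" "has_valuation p 0 d'" using has_valuation_0 d by auto
  obtain k where k: "has_valuation p k y" using has_valuation_exists sq(2) by blast
  have y: "has_valuation p (k + k) (y\<^sup>2)" using has_valuation_mult[OF k k]
    by (simp add: power2_eq_square)
  have "n \<noteq> 0" using n(2) by auto
  then consider "n < 0" | "0 < n" by linarith
  then show False
  proof cases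
    case 1
    then have "has_valuation p (n + n + n) (y\<^sup>2)"
      unfolding sq(1)[symmetric] using has_valuation_add v n(1) by (intro has_valuation_mult) auto
    then have "n + n + n = k + k" using y has_valuation_unique by blast
    then show False using n(2) by presburger
  next
    case 2
    then have "has_valuation p 0 (d + z)" "has_valuation p 0 (d' + z)"
      using has_valuation_add v n(1) by auto
    then have "has_valuation p (n + 0 + 0) (y\<^sup>2)"
      unfolding sq(1)[symmetric] by (intro has_valuation_mult n(1)) (simp_all add: add.commute)
    then have "n + 0 + 0 = k + k" using y has_valuation_unique by blast
    then show False using n(2) by presburger
  qed
qed

end

text \<open>A prime of the squarefree \<open>h\<close> occurs in it exactly once, so
  \<open>z = h * s^2\<close> has odd valuation there and \<open>odd_valuation_divides\<close>
  applies.\<close>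

lemma sqfree_part_divides:
  assumes h: "h \<in> A" "sqfree_in A h" and z: "z = h * s\<^sup>2" "z * (z + d) * (z + d') = y\<^sup>2" "y \<noteq> 0"
    and d: "d \<in> A" "d' \<in> A"
  shows "divides_in A h (d * d')"
proof (rule sqfree_dividesI[OF factorable[OF h(1)] h(2)])
  show "h \<noteq> 0" using z by auto
  show "d * d' \<in> A" using d mult_mem by blast
  fix p assume p: "prime_in A p" "divides_in A p h"
  then obtain g where g: "g \<in> A" "h = p * g" by (auto simp: divides_in_def)
  have "\<not> divides_in A p g"
  proof
    assume "divides_in A p g"
    then have "divides_in A (p * p) h" using g(2) by (auto simp: divides_in_def mult.assoc)
    then show False using h(2) p(1) by (auto simp: sqfree_in_def prime_in_def)
  qed
  then have "has_valuation p (1 + 0) h"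
    unfolding g(2) using has_valuation_mult has_valuation_1 has_valuation_0 g(1) p(1) by blast
  moreover have "s \<noteq> 0" using z by auto
  then obtain k where k: "has_valuation p k s" using has_valuation_exists[OF p(1)] by blast
  ultimately have "has_valuation p ((1 + 0) + (k + k)) z"
    unfolding z(1) power2_eq_square using has_valuation_mult[OF p(1)] k by blast
  then show "divides_in A p (d * d')"
    by (rule odd_valuation_divides[OF p(1) _ _ z(2,3) d]) simp
qed

lemma unit_in_divide:
  assumes "unit_in A u" "unit_in A v"
  shows "unit_in A (u / v)"
proof -
  obtain w where w: "w \<in> A" "v * w = 1" using assms(2) by (auto simp: unit_in_def)
  then have "unit_in A w" using unit_in_mem[OF assms(2)] by (auto simp: unit_in_def mult.commute)
  moreover have "u / v = u * w" using w unit_in_neq_0[OF assms(2)] by (simp add: field_simps)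
  ultimately show ?thesis using unit_in_mult assms(1) by simp
qed

end

text \<open>\<open>nonsquare\<close> is (C) turned round: a nonconstant \<open>h\<close> with square
  value is excluded, and a constant one equals that square. \<open>ev_unit_inj\<close> records that
  units of R[t] are constants.\<close>

locale descent = place reg ev + ufd_of_field A
  for reg :: "'a::field \<Rightarrow> bool" and ev :: "'a \<Rightarrow> 'b::field_char_0" and A :: "'a set" +
  fixes e1 e2 e3 :: 'a
  assumes reg_A: "a \<in> A \<Longrightarrow> reg a"
    and ev_unit_inj: "unit_in A u \<Longrightarrow> unit_in A v \<Longrightarrow> ev u = ev v \<Longrightarrow> u = v"
    and e_mem: "e1 \<in> A" "e2 \<in> A" "e3 \<in> A"
    and e_distinct: "e1 \<noteq> e2" "e1 \<noteq> e3" "e2 \<noteq> e3"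
    and nonsquare: "h \<in> A \<Longrightarrow> sqfree_in A h \<Longrightarrow>
      f \<in> {(e1 - e2) * (e1 - e3), (e2 - e1) * (e2 - e3), (e3 - e1) * (e3 - e2)} \<Longrightarrow>
      divides_in A h f \<Longrightarrow> ev h = z\<^sup>2 \<Longrightarrow> \<exists>w. h = w\<^sup>2"
begin

text \<open>The roots enter as \<open>f1\<close>, \<open>f2\<close>, \<open>f3\<close>, so that one
  proof covers all their orders.\<close>

lemma ev_neq:
  assumes "f1 \<in> A" "f2 \<in> A" "f3 \<in> A" "f1 \<noteq> f2"
    and "(f1 - f2) * (f1 - f3) \<in> {(e1 - e2) * (e1 - e3), (e2 - e1) * (e2 - e3), (e3 - e1) * (e3 -
      e2)}"
  shows "ev f1 \<noteq> ev f2"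
proof
  assume "ev f1 = ev f2"
  then have ev0: "ev (f1 - f2) = 0" using assms reg_A ev_diff by simp
  \<comment> \<open>Units have nonzero values, so a vanishing value comes from a prime
    factor.\<close>
  have "prime_product A a \<Longrightarrow> ev a = 0 \<Longrightarrow> \<exists>p. prime_in A p \<and> divides_in A p a \<and> ev p = 0" for a
  proof (induction rule: prime_product.induct)
    case (unit u)
    then obtain v where "u \<in> A" "v \<in> A" "u * v = 1" by (auto simp: unit_in_def)
    then have "ev u * ev v = 1" using ev_mult reg_A ev_one by metis
    then show ?case using unit(2) by simp
  next
    case (mult q a)
    have mem: "q \<in> A" "a \<in> A" using mult(1,2) prime_in_mem prime_product_mem by auto
    then have "ev q = 0 \<or> ev a = 0" using mult(4) ev_mult reg_A by simp
    moreover have "divides_in A q (q * a)" using mem unfolding divides_in_def by blast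
    moreover have "divides_in A p (q * a)" if "divides_in A p a" for p
      using divides_in_mult[OF that mem(1)] by (simp add: mult.commute)
    ultimately show ?case using mult by blast
  qed
  moreover have "prime_product A (f1 - f2)" using assms diff_mem factorable by simp
  ultimately obtain p where p: "prime_in A p" "divides_in A p (f1 - f2)" "ev p = 0\<^sup>2"
    using ev0 by auto
  have "divides_in A p ((f1 - f2) * (f1 - f3))" using divides_in_mult p(2) diff_mem assms by blast
  \<comment> \<open>Here \<open>nonsquare\<close> yields only that \<open>p\<close> is a square; a
    prime is squarefree, so \<open>w\<close> and hence \<open>p\<close> would be units.\<close>
  then obtain w where w: "p = w\<^sup>2"
    using nonsquare[OF prime_in_mem[OF p(1)] prime_in_sqfree[OF p(1)] assms(5) _ p(3)] by blast
  then have "w \<in> A" using root_mem prime_in_mem[OF p(1)] by blast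
  moreover have "divides_in A (w * w) p" using w one_mem unfolding divides_in_def power2_eq_square
    by force
  ultimately have "unit_in A w" using prime_in_sqfree[OF p(1)] by (simp add: sqfree_in_def)
  then have "unit_in A p" using w unit_in_mult by (simp add: power2_eq_square)
  then show False using p(1) by (simp add: prime_in_def)
qed

lemma ev_e_distinct: "ev e1 \<noteq> ev e2" "ev e1 \<noteq> ev e3" "ev e2 \<noteq> ev e3"
  using ev_neq[of e1 e2 e3] ev_neq[of e1 e3 e2] ev_neq[of e2 e3 e1] e_mem e_distinct
  by (simp_all add: mult.commute)

text \<open>The comparison of leading coefficients is the identity \<open>h * r^2 * t = 1\<close>
  with \<open>r = s * x / y\<close>, where \<open>t = (x - f2) * (x - f3) / x^2\<close> has value 1
  because \<open>x\<close> has a pole.\<close>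

lemma pole_square:
  assumes f: "f1 \<in> A" "f2 \<in> A" "f3 \<in> A"
    and "(f1 - f2) * (f1 - f3) \<in> {(e1 - e2) * (e1 - e3), (e2 - e1) * (e2 - e3), (e3 - e1) * (e3 -
      e2)}"
    and y: "(x - f1) * (x - f2) * (x - f3) = y\<^sup>2" and x: "\<not> reg x"
  shows "\<exists>a. x - f1 = a\<^sup>2"
proof -
  have x0: "x \<noteq> 0" using x reg_zero by auto
  define w where "w = inverse x"
  have w: "reg w" "ev w = 0" using x by (simp_all add: w_def reg_inverse_pole ev_inverse_pole)
  have "x - f1 \<noteq> 0" "x - f2 \<noteq> 0" "x - f3 \<noteq> 0" using x f reg_A by auto
  then have nz: "x - f1 \<noteq> 0" "y \<noteq> 0" using y by auto
  obtain h s where h: "h \<in> A" "sqfree_in A h" "x - f1 = h * s\<^sup>2" using ex_sqfree_part nz(1) by blast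
  have "(x - f1) * ((x - f1) + (f1 - f2)) * ((x - f1) + (f1 - f3)) = y\<^sup>2" using y by simp
  then have dvd: "divides_in A h ((f1 - f2) * (f1 - f3))"
    using sqfree_part_divides[OF h _ nz(2)] f diff_mem by blast
  define r where "r = s * x / y"
  define t where "t = (1 - f2 * w) * (1 - f3 * w)"
  have t: "reg t" "ev t = 1" using w f reg_A by (simp_all add: t_def reg_rules ev_rules)
  then have t0: "t \<noteq> 0" using ev_zero by auto
  have "t * x\<^sup>2 = (x - f2) * (x - f3)" using x0
    by (simp add: t_def w_def field_simps power2_eq_square)
  then have "(h * s\<^sup>2) * (t * x\<^sup>2) = y\<^sup>2" using y h(3) by (simp add: ac_simps)
  then have hr: "h * r\<^sup>2 * t = 1" using nz(2)
    by (simp add: r_def power_mult_distrib power_divide field_simps)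
  \<comment> \<open>A value 0 is already a square. Otherwise \<open>r^2\<close> is the inverse of
    the regular \<open>h * t\<close>, so \<open>r\<close> is regular and its value provides the
    root.\<close>
  have "\<exists>z. ev h = z\<^sup>2"
  proof (cases "ev h = 0")
    case False
    then have ht: "reg (h * t)" "ev (h * t) = ev h" using h(1) reg_A t
      by (simp_all add: reg_mult ev_mult)
    have "(h * t) * r\<^sup>2 = 1" using hr by (simp add: ac_simps)
    then have r2: "r\<^sup>2 = inverse (h * t)" using inverse_unique by metis
    then have "reg (r\<^sup>2)" using ht False reg_inverse by metis
    then have "reg r" by (simp add: reg_power_iff)
    then have "(ev r)\<^sup>2 = inverse (ev h)" using r2 ht False ev_power ev_inverse by metis
    then have "ev h = (inverse (ev r))\<^sup>2" by (simp add: power_inverse)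
    then show ?thesis by blast
  qed (intro exI[of _ 0], simp)
  then obtain w where "h = w\<^sup>2" using nonsquare[OF h(1,2) assms(4) dvd] by blast
  then have "x - f1 = (w * s)\<^sup>2" using h(3) by (simp add: power_mult_distrib)
  then show ?thesis by blast
qed

text \<open>The ratios fix the signs so that the half computed from the triple again has a pole;
  each of the other sign patterns gives a half that is regular there, its abscissa reducing to that
  of a 2-torsion point.\<close>

definition root_triple :: "'a \<Rightarrow> 'a \<times> 'a \<times> 'a \<Rightarrow> bool" where
  "root_triple x = (\<lambda>(a1, a2, a3). a1\<^sup>2 = x - e1 \<and> a2\<^sup>2 = x - e2 \<and> a3\<^sup>2 = x - e3 \<and> \<not> reg a1 \<and>
     reg (a2 / a1) \<and> ev (a2 / a1) = 1 \<and> reg (a3 / a1) \<and> ev (a3 / a1) = 1)"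

text \<open>\<open>(b / a)^2 = 1 + (e1 - e) / a^2\<close> has value 1, since \<open>a\<close> has a
  pole; so \<open>b / a\<close> has value 1 or -1, and a sign change suffices.\<close>

lemma root_sign:
  assumes a: "a\<^sup>2 = x - e1" "b\<^sup>2 = x - e" "\<not> reg a" "e \<in> A"
  shows "\<exists>c. c\<^sup>2 = x - e \<and> reg (c / a) \<and> ev (c / a) = 1"
proof -
  have a0: "a \<noteq> 0" using a(3) reg_zero by auto
  define w where "w = inverse a"
  have w: "reg w" "ev w = 0" using a(3) by (simp_all add: w_def reg_inverse_pole ev_inverse_pole)
  have "b\<^sup>2 = a\<^sup>2 + (e1 - e)" using a by simp
  then have ba: "(b / a)\<^sup>2 = 1 + (e1 - e) * w\<^sup>2"
    using a0 by (simp add: w_def power_divide field_simps)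
  then have "reg ((b / a)\<^sup>2)" "ev ((b / a)\<^sup>2) = 1"
    using w a(4) e_mem reg_A by (simp_all add: reg_rules ev_rules)
  then have r: "reg (b / a)" "(ev (b / a))\<^sup>2 = 1" using reg_power_iff[of 2 "b / a"] ev_power by auto
  then consider "ev (b / a) = 1" | "ev (b / a) = - 1" using power2_eq_1_iff by blast
  then show ?thesis
  proof cases
    case 1
    then show ?thesis using r a(2) by blast
  next
    case 2
    then have "(- b)\<^sup>2 = x - e" "reg (- b / a)" "ev (- b / a) = 1"
      using r a(2) reg_uminus[OF r(1)] ev_uminus[OF r(1)] by simp_all
    then show ?thesis by blast
  qed
qed

lemma ex_root_triple:
  assumes y: "(x - e1) * (x - e2) * (x - e3) = y\<^sup>2" and x: "\<not> reg x"
  shows "\<exists>a. root_triple x a"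
proof -
  have "\<exists>a. x - e1 = a\<^sup>2"
    by (rule pole_square[OF e_mem(1,2,3) _ y x]) simp
  moreover have "\<exists>a. x - e2 = a\<^sup>2"
    by (rule pole_square[OF e_mem(2,1,3) _ _ x, where y = y]) (use y in \<open>simp_all add: ac_simps\<close>)
  moreover have "\<exists>a. x - e3 = a\<^sup>2"
    by (rule pole_square[OF e_mem(3,1,2) _ _ x, where y = y]) (use y in \<open>simp_all add: ac_simps\<close>)
  ultimately obtain a b c where abc: "a\<^sup>2 = x - e1" "b\<^sup>2 = x - e2" "c\<^sup>2 = x - e3" by metis
  have "\<not> reg a"
  proof
    assume "reg a"
    then have "reg (a\<^sup>2 + e1)" using e_mem reg_A by (simp add: reg_rules)
    then show False using abc x by simp
  qed
  then show ?thesis using root_sign[OF abc(1,2)] root_sign[OF abc(1,3)] abc(1) e_mem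
    unfolding root_triple_def by blast
qed

text \<open>The square roots \<open>b\<close> belong to the half of the point with roots \<open>a\<close> that also reduces to
  infinity:
  halving multiplies the leading coefficient of \<open>x\<close> by \<open>4\<close>.\<close>

definition halves :: "'a \<times> 'a \<times> 'a \<Rightarrow> 'a \<times> 'a \<times> 'a \<Rightarrow> bool" where
  "halves = (\<lambda>(a1, a2, a3) (b1, b2, b3). b1\<^sup>2 = (a1 + a2) * (a1 + a3) \<and>
    b2\<^sup>2 = (a2 + a1) * (a2 + a3) \<and>
     b3\<^sup>2 = (a3 + a1) * (a3 + a2) \<and> reg (b1 / a1) \<and> (ev (b1 / a1))\<^sup>2 = 4)"

lemma ex_halves:
  assumes "root_triple x a"
  shows "\<exists>x' b. root_triple x' b \<and> halves a b"
proof -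
  obtain a1 a2 a3 where a: "a = (a1, a2, a3)" by (cases a)
  have t: "a1\<^sup>2 = x - e1" "a2\<^sup>2 = x - e2" "a3\<^sup>2 = x - e3" "\<not> reg a1"
    "reg (a2 / a1)" "ev (a2 / a1) = 1" "reg (a3 / a1)" "ev (a3 / a1) = 1"
    using assms by (simp_all add: a root_triple_def)
  define x' where "x' = x + a1 * a2 + a1 * a3 + a2 * a3"
  have x': "x' - e1 = (a1 + a2) * (a1 + a3)" "x' - e2 = (a2 + a1) * (a2 + a3)"
    "x' - e3 = (a3 + a1) * (a3 + a2)"
    using t(1-3) by (simp_all add: x'_def power2_eq_square algebra_simps)
  \<comment> \<open>Each of the three sums occurs twice in the product, so \<open>x'\<close> is the
    abscissa of a point of the curve and \<open>ex_root_triple\<close> can be applied to it.\<close>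
  then have y: "(x' - e1) * (x' - e2) * (x' - e3) = ((a1 + a2) * (a1 + a3) * (a2 + a3))\<^sup>2"
    by (simp add: power2_eq_square ac_simps)
  have a0: "a1 \<noteq> 0" using t(4) reg_zero by auto
  \<comment> \<open>\<open>u\<close> is \<open>(x' - e1) / a1^2\<close>; by the choice of signs both
    factors have value 1 + 1, whence the 4.\<close>
  define u where "u = (1 + a2 / a1) * (1 + a3 / a1)"
  have u: "reg u" "ev u = 4" using t by (simp_all add: u_def reg_rules ev_rules)
  then have u0: "u \<noteq> 0" using ev_zero by auto
  have xu: "x' - e1 = u * a1\<^sup>2"
    unfolding x' u_def using a0 by (simp add: field_simps power2_eq_square)
  have "\<not> reg x'"
  proof
    assume "reg x'"
    then have "reg ((x' - e1) / u)" using u e_mem reg_A reg_diff reg_divide by simp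
    then have "reg (a1\<^sup>2)" using xu u0 by simp
    then show False using t(4) reg_power_iff[of 2 a1] by simp
  qed
  then obtain b where b: "root_triple x' b" using ex_root_triple[OF y] by blast
  obtain b1 b2 b3 where bb: "b = (b1, b2, b3)" by (cases b)
  have "(b1 / a1)\<^sup>2 = u" using b xu a0 by (simp add: bb root_triple_def power_divide)
  then have "reg (b1 / a1)" "(ev (b1 / a1))\<^sup>2 = 4"
    using u reg_power_iff[of 2 "b1 / a1"] ev_power[of "b1 / a1" 2] by auto
  then have "halves a b" using b x' by (simp add: a bb halves_def root_triple_def)
  then show ?thesis using b by blast
qed

definition denominator :: "'a \<Rightarrow> 'a \<times> 'a \<times> 'a \<Rightarrow> bool" where
  "denominator Z = (\<lambda>(a1, a2, a3). Z * a1 \<in> A \<and> Z * a2 \<in> A \<and> Z * a3 \<in> A)"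

lemma ex_denominator: "\<exists>Z\<in>A. Z \<noteq> 0 \<and> denominator Z a"
proof -
  obtain a1 a2 a3 where a: "a = (a1, a2, a3)" by (cases a)
  obtain n1 d1 n2 d2 n3 d3 where *: "n1 \<in> A" "d1 \<in> A" "d1 \<noteq> 0" "a1 = n1 / d1"
    "n2 \<in> A" "d2 \<in> A" "d2 \<noteq> 0" "a2 = n2 / d2" "n3 \<in> A" "d3 \<in> A" "d3 \<noteq> 0" "a3 = n3 / d3"
    using frac by metis
  then have "d1 * d2 * d3 * a1 = n1 * d2 * d3" "d1 * d2 * d3 * a2 = n2 * d1 * d3"
    "d1 * d2 * d3 * a3 = n3 * d1 * d2"
    by simp_all
  then have "denominator (d1 * d2 * d3) a" using * mult_mem by (simp add: denominator_def a)
  moreover have "d1 * d2 * d3 \<in> A" "d1 * d2 * d3 \<noteq> 0" using * mult_mem by simp_all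
  ultimately show ?thesis by blast
qed

text \<open>The equations in \<open>halves\<close> are homogeneous of degree 2, so the same
  \<open>Z\<close> puts \<open>(Z * d)^2\<close> into \<open>A\<close>, and \<open>root_mem\<close>
  extracts the root: denominators do not grow along the chain.\<close>

lemma denominator_halves:
  assumes "denominator Z a" "halves a b"
  shows "denominator Z b"
proof -
  obtain a1 a2 a3 b1 b2 b3 where ab: "a = (a1, a2, a3)" "b = (b1, b2, b3)" by (cases a, cases b)
  have root: "Z * d \<in> A" if d: "d\<^sup>2 = (p + q) * (p + r)" "Z * p \<in> A" "Z * q \<in> A" "Z * r \<in> A"
    for d p q r
  proof -
    have "(Z * d)\<^sup>2 = (Z * p + Z * q) * (Z * p + Z * r)"
      using d(1) by (simp add: power_mult_distrib power2_eq_square algebra_simps)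
    also have "\<dots> \<in> A" using d add_mem mult_mem by simp
    finally show ?thesis by (rule root_mem)
  qed
  then show ?thesis using assms by (auto simp: ab denominator_def halves_def)
qed

text \<open>The factorizations \<open>(Z a1 + Z a2) (Z a1 - Z a2) =
  (e2 - e1) Z\<^sup>2\<close> leave only finitely many classes of
  \<open>Z a1 + Z a2\<close> up to units. If two triples in a chain of halves agree in these classes, then
    passing from
  one to the other scales \<open>a1 + a2\<close> and \<open>a1 + a3\<close> by the same unit, hence \<open>a1 - a2\<close> and \<open>a1 - a3\<close>
    by its
  inverse, and \<open>a3 - a2\<close> by both.\<close>

lemma no_pole:
  assumes y: "(x - e1) * (x - e2) * (x - e3) = y\<^sup>2"
  shows "reg x"
proof (rule ccontr)
  assume x: "\<not> reg x"
  obtain a where a: "root_triple x a" using ex_root_triple[OF y x] by blast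
  obtain Z where Z: "Z \<in> A" "Z \<noteq> 0" "denominator Z a" using ex_denominator by blast
  have "\<exists>f. \<forall>n. ((\<exists>x. root_triple x (f n)) \<and> denominator Z (f n)) \<and> halves (f n) (f (Suc n))"
    using a Z(3) ex_halves denominator_halves
    by (intro dependent_nat_choice) blast+
  then obtain f where f: "\<And>n. \<exists>x. root_triple x (f n)" "\<And>n. denominator Z (f n)"
    "\<And>n. halves (f n) (f (Suc n))"
    by blast
  define a1 a2 a3 where "a1 n = fst (f n)" and "a2 n = fst (snd (f n))" and "a3 n = snd (snd (f n))"
    for n
  have f_eq: "f n = (a1 n, a2 n, a3 n)" for n by (simp add: a1_def a2_def a3_def)
  have t: "(a1 n)\<^sup>2 + e1 = (a2 n)\<^sup>2 + e2" "(a1 n)\<^sup>2 + e1 = (a3 n)\<^sup>2 + e3" "\<not> reg (a1 n)"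
    "reg (a2 n / a1 n)" "ev (a2 n / a1 n) = 1" "reg (a3 n / a1 n)" "ev (a3 n / a1 n) = 1"
    and den: "Z * a1 n \<in> A" "Z * a2 n \<in> A" "Z * a3 n \<in> A"
    and h: "reg (a1 (Suc n) / a1 n)" "(ev (a1 (Suc n) / a1 n))\<^sup>2 = 4" for n
    using f[of n] by (auto simp: f_eq root_triple_def denominator_def halves_def)
  have a0: "a1 n \<noteq> 0" for n using t(3)[of n] reg_zero by auto
  \<comment> \<open>Each single quotient has value 2 or -2; only squares are tracked, so the signs
    chosen along the chain do not matter.\<close>
  have ratio: "reg (a1 (n + k) / a1 n) \<and> (ev (a1 (n + k) / a1 n))\<^sup>2 = 4 ^ k" for n k
  proof (induction k)
    case 0
    then show ?case using a0 by (simp add: reg_one ev_one)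
  next
    case (Suc k)
    define p q where "p = a1 (Suc (n + k)) / a1 (n + k)" and "q = a1 (n + k) / a1 n"
    have "reg p" "(ev p)\<^sup>2 = 4" "reg q" "(ev q)\<^sup>2 = 4 ^ k" using Suc h
      by (simp_all add: p_def q_def)
    moreover have "a1 (n + Suc k) / a1 n = p * q" using a0 by (simp add: p_def q_def)
    ultimately show ?case by (simp add: reg_mult ev_mult power_mult_distrib)
  qed
  \<comment> \<open>The right sides do not depend on \<open>n\<close>: this bounds the factors up to
    units and makes sums and differences scale inversely.\<close>
  have prod: "(a1 n + a2 n) * (a1 n - a2 n) = e2 - e1" "(a1 n + a3 n) * (a1 n - a3 n) = e3 - e1"
    "(a3 n + a2 n) * (a3 n - a2 n) = e2 - e3" for n
    using t(1,2)[of n] by (simp_all add: power2_eq_square algebra_simps)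
  have classes: "\<exists>c u. finite (range c) \<and> (\<forall>n. unit_in A (u n) \<and> Z * (a1 n + b n) = u n * c n)"
    if b: "\<And>n. Z * b n \<in> A" "\<And>n. (a1 n + b n) * (a1 n - b n) = d" "d \<noteq> 0" for b d
  proof -
    have dvd: "Z * (a1 n + b n) \<in> A" "divides_in A (Z * (a1 n + b n)) (d * Z\<^sup>2)" for n
    proof -
      show "Z * (a1 n + b n) \<in> A" using den(1) b(1) add_mem by (simp add: distrib_left)
      have "Z * (a1 n - b n) \<in> A" using den(1) b(1) diff_mem by (simp add: right_diff_distrib)
      moreover have "d * Z\<^sup>2 = Z * (a1 n + b n) * (Z * (a1 n - b n))"
        unfolding b(2)[of n, symmetric] by (simp add: power2_eq_square)
      ultimately show "divides_in A (Z * (a1 n + b n)) (d * Z\<^sup>2)" unfolding divides_in_def by blast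
    qed
    have "d * Z\<^sup>2 = Z * (a1 0 + b 0) * (Z * (a1 0 - b 0))"
      unfolding b(2)[of 0, symmetric] by (simp add: power2_eq_square)
    moreover have "Z * (a1 0 - b 0) \<in> A" using den(1) b(1) diff_mem
      by (simp add: right_diff_distrib)
    ultimately have "d * Z\<^sup>2 \<in> A" using dvd(1) mult_mem by simp
    then have "prime_product A (d * Z\<^sup>2)" using factorable b(3) Z(2) by simp
    from prime_product_finite_divisors[OF this] obtain S where S: "finite S"
      "\<forall>e\<in>A. divides_in A e (d * Z\<^sup>2) \<longrightarrow> (\<exists>s\<in>S. \<exists>u. unit_in A u \<and> e = u * s)" by blast
    have "\<exists>c u. c \<in> S \<and> unit_in A u \<and> Z * (a1 n + b n) = u * c" for n
      using S(2)[rule_format, OF dvd[of n]] by blast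
    then obtain c u where "\<And>n. c n \<in> S \<and> unit_in A (u n) \<and> Z * (a1 n + b n) = u n * c n" by metis
    moreover from this have "finite (range c)" using S(1) finite_subset[of "range c" S] by blast
    ultimately show ?thesis by blast
  qed
  have diff0: "e2 - e1 \<noteq> 0" "e3 - e1 \<noteq> 0" using e_distinct by auto
  obtain c2 u2 where c2: "finite (range c2)" "\<And>n. unit_in A (u2 n)"
    "\<And>n. Z * (a1 n + a2 n) = u2 n * c2 n"
    using classes[of a2, OF den(2) prod(1) diff0(1)] by blast
  obtain c3 u3 where c3: "finite (range c3)" "\<And>n. unit_in A (u3 n)"
    "\<And>n. Z * (a1 n + a3 n) = u3 n * c3 n"
    using classes[of a3, OF den(3) prod(2) diff0(2)] by blast
  have "finite (range (\<lambda>n. (c2 n, c3 n)))"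
    by (rule finite_subset[of _ "range c2 \<times> range c3"]) (use c2(1) c3(1) in auto)
  then have "\<not> inj (\<lambda>n. (c2 n, c3 n))" using finite_imageD infinite_UNIV_nat by blast
  then obtain i j where ij: "c2 i = c2 j" "c3 i = c3 j" "i \<noteq> j" by (auto simp: inj_def)
  obtain n m where nm: "c2 n = c2 m" "c3 n = c3 m" "n < m"
    using ij by (metis linorder_neqE_nat)
  define r where "r = a1 m / a1 n"
  have r: "reg r" "(ev r)\<^sup>2 = 4 ^ (m - n)" using ratio[of n "m - n"] nm(3) by (auto simp: r_def)
  \<comment> \<open>Both \<open>1 + b n / a1 n\<close> and \<open>1 + b m / a1 m\<close> have value
    2, so the unit \<open>l\<close> has the value of \<open>a1 m / a1 n\<close>, whether
    \<open>b\<close> is \<open>a2\<close> or \<open>a3\<close>; hence the two units will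
    coincide.\<close>
  have scale: "unit_in A l \<and> ev l = ev r \<and> a1 m + b m = l * (a1 n + b n)"
    if b: "\<And>n. reg (b n / a1 n)" "\<And>n. ev (b n / a1 n) = 1" and l: "l = v m / v n"
      and v: "\<And>n. unit_in A (v n)" "\<And>n. Z * (a1 n + b n) = v n * c n" "c n = c m" for b v c l
  proof (intro conjI)
    show u: "unit_in A l" unfolding l using v(1) unit_in_divide by blast
    have v0: "v n \<noteq> 0" using v(1) unit_in_neq_0 by blast
    have "Z * (l * (a1 n + b n)) = l * (Z * (a1 n + b n))" by (rule mult.left_commute)
    also have "\<dots> = v m * c m" unfolding v(2) l using v0 v(3) by simp
    finally have "Z * (a1 m + b m) = Z * (l * (a1 n + b n))" unfolding v(2) ..
    then show s: "a1 m + b m = l * (a1 n + b n)" using Z(2) by simp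
    have rl: "reg l" using u unit_in_mem reg_A by blast
    have "r * (1 + b m / a1 m) = l * (1 + b n / a1 n)"
      using s a0[of n] a0[of m] by (simp add: r_def field_simps)
    then have "ev (r * (1 + b m / a1 m)) = ev (l * (1 + b n / a1 n))" by simp
    then show "ev l = ev r" using b r(1) rl by (simp add: reg_rules ev_rules)
  qed
  define l where "l = u2 m / u2 n"
  have l2: "unit_in A l" "ev l = ev r" "a1 m + a2 m = l * (a1 n + a2 n)"
    using scale[of a2 l u2 c2, OF t(4,5) l_def c2(2,3) nm(1)] by auto
  have l3: "unit_in A (u3 m / u3 n)" "ev (u3 m / u3 n) = ev r"
    "a1 m + a3 m = (u3 m / u3 n) * (a1 n + a3 n)"
    using scale[of a3 _ u3 c3, OF t(6,7) refl c3(2,3) nm(2)] by auto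
  have "u3 m / u3 n = l" using ev_unit_inj l2(1,2) l3(1,2) by simp
  then have l3': "a1 m + a3 m = l * (a1 n + a3 n)" using l3(3) by simp
  have pq: "a1 n + a2 n \<noteq> 0" "a1 n + a3 n \<noteq> 0" "a3 n - a2 n \<noteq> 0"
    using prod[of n] diff0 e_distinct by auto
  have minus: "l * (a1 m - b m) = a1 n - b n"
    if "(a1 m + b m) * (a1 m - b m) = (a1 n + b n) * (a1 n - b n)" "a1 m + b m = l * (a1 n + b n)"
      "a1 n + b n \<noteq> 0" for b
    using that by (simp add: ac_simps)
  have l': "l * (a1 m - a2 m) = a1 n - a2 n" "l * (a1 m - a3 m) = a1 n - a3 n"
    using minus[OF trans[OF prod(1)[of m] prod(1)[of n, symmetric]] l2(3) pq(1)]
      minus[OF trans[OF prod(2)[of m] prod(2)[of n, symmetric]] l3' pq(2)] by blast+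
  have "l * (a3 m - a2 m) = l * (a1 m - a2 m) - l * (a1 m - a3 m)" by (simp add: algebra_simps)
  then have "l * (a3 m - a2 m) = a3 n - a2 n" unfolding l' by simp
  moreover have "a3 m - a2 m = (a1 m + a3 m) - (a1 m + a2 m)" by simp
  then have "a3 m - a2 m = l * (a3 n - a2 n)" unfolding l2(3) l3' by (simp add: algebra_simps)
  ultimately have "l\<^sup>2 * (a3 n - a2 n) = 1 * (a3 n - a2 n)" by (simp add: power2_eq_square ac_simps)
  then have "l\<^sup>2 = 1" using pq(3) mult_right_cancel by blast
  moreover have "reg l" using l2(1) unit_in_mem reg_A by blast
  ultimately have "(ev l)\<^sup>2 = 1" using ev_power ev_one by metis
  then have "(4::'b) ^ (m - n) = 1" using r(2) l2(2) by simp
  moreover have "(4::'b) ^ (m - n) = of_nat (4 ^ (m - n))" by simp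
  ultimately have "(4::nat) ^ (m - n) = 1" by (metis of_nat_1 of_nat_eq_iff)
  then show False using nm(3) by simp
qed

section \<open>Good reduction, trivial kernel and injectivity\<close>

definition "w2 = - (e1 + e2 + e3)"
definition "w4 = e1 * e2 + e1 * e3 + e2 * e3"
definition "w6 = - (e1 * e2 * e3)"

lemma curve_factor: "(x - e1) * (x - e2) * (x - e3) = x^3 + w2 * x\<^sup>2 + w4 * x + w6"
  by (simp add: w2_def w4_def w6_def power2_eq_square power3_eq_cube algebra_simps)

lemma reg_e: "reg e1" "reg e2" "reg e3"
  using e_mem reg_A by auto

lemma ev_coeffs: "ev w2 = - (ev e1 + ev e2 + ev e3)"
    "ev w4 = ev e1 * ev e2 + ev e1 * ev e3 + ev e2 * ev e3" "ev w6 = - (ev e1 * ev e2 * ev e3)"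
  unfolding w2_def w4_def w6_def using reg_e by (simp_all only: reg_rules ev_rules)

sublocale curve: good_reduction reg ev w2 w4 w6
proof
  show "reg w2" "reg w4" "reg w6"
    unfolding w2_def w4_def w6_def using reg_e by (simp_all only: reg_rules)
  show "(2::'b) \<noteq> 0" by simp
  define c1 c2 c3 where c: "c1 = ev e1" "c2 = ev e2" "c3 = ev e3"
  fix x
  assume "x^3 + ev w2 * x\<^sup>2 + ev w4 * x + ev w6 = 0"
  then have "(x - c1) * (x - c2) * (x - c3) = 0"
    unfolding ev_coeffs c by (simp add: power2_eq_square power3_eq_cube algebra_simps)
  then consider "x = c1" | "x = c2" | "x = c3" by auto
  \<comment> \<open>The derivative of the cubic in factored form: at a root it is the product of the
    differences to the other two.\<close>
  then have "(x - c1) * (x - c2) + (x - c1) * (x - c3) + (x - c2) * (x - c3) \<noteq> 0"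
    using ev_e_distinct unfolding c[symmetric] by cases auto
  moreover have "3 * x\<^sup>2 + 2 * ev w2 * x + ev w4 =
    (x - c1) * (x - c2) + (x - c1) * (x - c3) + (x - c2) * (x - c3)"
    unfolding ev_coeffs c by (simp add: power2_eq_square algebra_simps)
  ultimately show "3 * x\<^sup>2 + 2 * ev w2 * x + ev w4 \<noteq> 0" by simp
qed

lemma curve_W: "curve_of_roots e1 e2 e3 = curve.W"
  by (simp add: curve_of_roots_def w2_def w4_def w6_def)

lemma reduced_curve_W: "curve_of_roots (ev e1) (ev e2) (ev e3) = curve.red.W"
  by (simp add: curve_of_roots_def ev_coeffs)

lemma reg_x: "curve.on_curve x y \<Longrightarrow> reg x"
  by (rule no_pole[of x y]) (simp add: curve.on_curve_def curve_factor)

lemma reduce_eq_Infinity: "P \<in> curve_points curve.W \<Longrightarrow> reduce P = Infinity \<Longrightarrow> P = Infinity"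
  by (cases P) (simp_all add: curve.curve_points_iff reg_x curve.reduce_affine del: reduce.simps(2))

text \<open>Injectivity follows from the trivial kernel without associativity: if \<open>P\<close>
  and \<open>Q\<close> have the same image, then \<open>P\<close> plus the negative of
  \<open>Q\<close> reduces to \<open>Infinity\<close>, hence is \<open>Infinity\<close>.\<close>

lemma reduce_mon:
  "reduce \<in> mon (curve_group (curve_of_roots e1 e2 e3))
    (curve_group (curve_of_roots (ev e1) (ev e2) (ev e3)))"
proof -
  have "reduce \<in> hom (curve_group curve.W) (curve_group curve.red.W)"
    by (rule homI) (simp_all add: curve_group_def curve.reduce_closed curve.reduce_add)
  moreover have "inj_on reduce (curve_points curve.W)"
  proof (rule inj_onI)
    fix P Q assume P: "P \<in> curve_points curve.W" and Q: "Q \<in> curve_points curve.W"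
      and eq: "reduce P = reduce Q"
    show "P = Q"
    proof (cases P; cases Q)
      fix x1 y1 x2 y2 assume PQ: "P = Affine x1 y1" "Q = Affine x2 y2"
      then have c: "curve.on_curve x1 y1" "curve.on_curve x2 y2"
        using P Q by (simp_all add: curve.curve_points_iff)
      define N where "N = Affine x2 (- y2)"
      have N: "N \<in> curve_points curve.W"
        using c(2) by (simp add: N_def curve.curve_points_iff curve.on_curve_def)
      have r: "reg x1" "reg x2" "reg y1" "reg y2" using c reg_x curve.reg_y by blast+
      then have "ev x1 = ev x2" "ev y1 = ev y2" using eq PQ by simp_all
      then have "point_add curve.red.W (reduce P) (reduce N) = Infinity"
        using r by (simp add: PQ N_def reg_uminus ev_uminus curve.red.point_add_opposite)
      then have "reduce (point_add curve.W P N) = Infinity" using curve.reduce_add[OF P N] by simp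
      then have "point_add curve.W P N = Infinity"
        using reduce_eq_Infinity curve.point_add_closed[OF P N] by blast
      \<comment> \<open>The addition formula returns \<open>Infinity\<close> for affine points only
        if the abscissas agree and the ordinates are opposite.\<close>
      then show "P = Q"
        by (simp add: PQ N_def point_add.simps(3) Let_def split: if_splits)
    qed (use eq reduce_eq_Infinity[OF P] reduce_eq_Infinity[OF Q] in auto)
  qed
  ultimately show ?thesis
    unfolding mon_def curve_W reduced_curve_W by (simp add: curve_group_def)
qed

end

section \<open>Specialization of curves over a rational function field\<close>

lemma algebraic_int_multiple:
  fixes x :: "'a::field_char_0"
  assumes "algebraic x"
  shows "\<exists>d::int. d \<noteq> 0 \<and> algebraic_int (of_int d * x)"
proof -
  obtain p where p: "\<And>i. Polynomial.coeff p i \<in> \<int>" "p \<noteq> 0" "poly p x = 0"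
    using algebraicE[OF assms] by metis
  define n a where "n = Polynomial.degree p" and "a = lead_coeff p"
  have a: "a \<in> \<int>" "a \<noteq> 0" using p by (auto simp: a_def)
  have "n \<noteq> 0"
  proof
    assume "n = 0"
    then obtain c where "p = [:c:]" by (metis degree_0_id n_def)
    then show False using p by simp
  qed
  then obtain m where n: "n = Suc m" using not0_implies_Suc by blast
  \<comment> \<open>\<open>q\<close> is \<open>a^m * p(x)\<close> rewritten in the variable
    \<open>a * x\<close>: the coefficient of \<open>x^i\<close> gains \<open>a^(m - i)\<close>, and
    the leading term \<open>a^m * a * x^n\<close> becomes the monic \<open>(a * x)^n\<close>, as
    \<open>n = m + 1\<close>.\<close>
  define q where "q = monom 1 n + (\<Sum>i\<le>m. monom (Polynomial.coeff p i * a ^ (m - i)) i)"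
  have coeff_q: "Polynomial.coeff q k = (if k = n then 1 else
    if k \<le> m then Polynomial.coeff p k * a ^ (m - k) else 0)" for k
    by (auto simp: q_def coeff_sum n sum.delta)
  have "Polynomial.degree q = n"
    by (rule antisym[OF degree_le le_degree]) (auto simp: coeff_q n)
  then have "lead_coeff q = 1" by (simp add: coeff_q)
  moreover have "\<forall>i. Polynomial.coeff q i \<in> \<int>" using p(1) a(1) by (simp add: coeff_q)
  moreover have "poly q (a * x) = 0"
  proof -
    have "a ^ (m - i) * (a * x) ^ i = a ^ m * x ^ i" if "i \<le> m" for i
      using that by (simp add: power_mult_distrib mult.assoc[symmetric] flip: power_add)
    then have "poly q (a * x) = (a * x) ^ n + (\<Sum>i\<le>m. Polynomial.coeff p i * (a ^ m * x ^ i))"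
      by (simp add: q_def poly_sum poly_monom mult.assoc)
    also have "\<dots> = a ^ m * (\<Sum>i\<le>n. Polynomial.coeff p i * x ^ i)"
      by (simp add: n a_def n_def[symmetric] power_mult_distrib sum_distrib_left algebra_simps)
    also have "(\<Sum>i\<le>n. Polynomial.coeff p i * x ^ i) = poly p x" by (simp add: poly_altdef n_def)
    finally show ?thesis using p(3) by simp
  qed
  ultimately have "algebraic_int (a * x)" by (intro algebraic_int.intros)
  moreover obtain d where "a = of_int d" using a(1) by (elim Ints_cases)
  ultimately show ?thesis using a(2) by auto
qed

lemma number_field_algebraic:
  fixes x :: "'k::field_char_0"
  assumes "number_field TYPE('k)"
  shows "algebraic x"
proof -
  obtain B where "finite_dimensional_vector_space (\<lambda>(q::rat) (x::'k). of_rat q * x) B"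
    using assms by (auto simp: number_field_def)
  then interpret V: finite_dimensional_vector_space "\<lambda>(q::rat) (x::'k). of_rat q * x" B .
  show ?thesis
  \<comment> \<open>A linear relation is sought in the set of powers, where equal powers would
    collapse. If two coincide, their difference is the polynomial; otherwise the set is infinite,
    hence dependent.\<close>
  proof (cases "inj (\<lambda>i::nat. x ^ i)")
    case True
    then have "infinite (range (\<lambda>i::nat. x ^ i))" using finite_imageD infinite_UNIV_nat by blast
    then have "V.dependent (range (\<lambda>i::nat. x ^ i))" using V.finiteI_independent by blast
    then obtain T u where T: "finite T" "T \<subseteq> range (\<lambda>i::nat. x ^ i)" "(\<Sum>v\<in>T. of_rat (u v) * v) = 0"
      "\<exists>v\<in>T. u v \<noteq> 0"
      unfolding V.dependent_explicit by blast
    obtain I where I: "T = (\<lambda>i::nat. x ^ i) ` I" using T(2) by (meson subset_imageE)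
    have inj: "inj_on (\<lambda>i. x ^ i) I" using True by (meson inj_on_subset subset_UNIV)
    then have fin: "finite I" using T(1) I finite_imageD by blast
    define p where "p = (\<Sum>i\<in>I. monom (of_rat (u (x ^ i)) :: 'k) i)"
    have c: "Polynomial.coeff p k = (if k \<in> I then of_rat (u (x ^ k)) else 0)" for k
      using fin by (simp add: p_def coeff_sum sum.delta)
    obtain k where "k \<in> I" "u (x ^ k) \<noteq> 0" using T(4) I by auto
    then have "Polynomial.coeff p k \<noteq> 0" by (simp add: c)
    then have "p \<noteq> 0" by auto
    moreover have "poly p x = 0"
      using T(3) unfolding I by (simp add: p_def poly_sum poly_monom sum.reindex[OF inj])
    moreover have "Polynomial.coeff p i \<in> \<rat>" for i by (simp add: c)
    ultimately show ?thesis by (intro algebraicI'[of p])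
  next
    case False
    then obtain i j :: nat where ij: "x ^ i = x ^ j" "i \<noteq> j" by (auto simp: inj_def)
    define p where "p = monom (1::'k) i - monom 1 j"
    have "Polynomial.coeff p i = 1" using ij(2) by (simp add: p_def)
    then have "p \<noteq> 0" by auto
    moreover have "poly p x = 0" using ij(1) by (simp add: p_def poly_monom)
    moreover have "Polynomial.coeff p i \<in> \<rat>" for i by (simp add: p_def)
    ultimately show ?thesis by (intro algebraicI'[of p])
  qed
qed

section \<open>Translation of divisibility and factoriality from carrier-based rings\<close>

lemma ring_on_simps [simp]:
  "carrier (ring_on S) = S" "x \<otimes>\<^bsub>ring_on S\<^esub> y = x * y" "x \<oplus>\<^bsub>ring_on S\<^esub> y = x + y"
  "\<one>\<^bsub>ring_on S\<^esub> = 1" "\<zero>\<^bsub>ring_on S\<^esub> = 0"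
  by (simp_all add: ring_on_def)

lemma divides_ring_on_iff: "a divides\<^bsub>ring_on S\<^esub> b \<longleftrightarrow> divides_in S a b"
  by (simp add: factor_def divides_in_def)

lemma Units_ring_on_iff: "u \<in> Units (ring_on S) \<longleftrightarrow> unit_in S u"
  by (auto simp: Units_def unit_in_def mult.commute)

lemma squarefree_in_ring_on_iff: "squarefree_in (ring_on S) h \<longleftrightarrow> sqfree_in S h"
  by (simp add: squarefree_in_def sqfree_in_def divides_ring_on_iff Units_ring_on_iff)

lemma ufd_subring_factorial_domain:
  fixes S :: "'a::idom set"
  assumes "factorial_domain (ring_on S)"
  shows "ufd_subring S"
proof -
  interpret F: factorial_domain "ring_on S" by fact
  interpret S: subring_set S
  proof
    show "1 \<in> S" using F.one_closed by simp
    show "a * b \<in> S" if "a \<in> S" "b \<in> S" for a b using F.m_closed that by simp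
    show "a - b \<in> S" if "a \<in> S" "b \<in> S" for a b
    proof -
      define c where "c = \<ominus>\<^bsub>ring_on S\<^esub> b"
      have c: "c \<in> S" "c + b = 0" using F.a_inv_closed[of b] F.l_neg[of b] that
        by (simp_all add: c_def)
      then have "a + c = a - b" by (simp add: eq_neg_iff_add_eq_0[symmetric])
      moreover have "a + c \<in> S" using F.a_closed[of a c] that c by simp
      ultimately show ?thesis by simp
    qed
  qed
  define G where "G = mult_of (ring_on S)"
  have G: "carrier G = S - {0}" "x \<otimes>\<^bsub>G\<^esub> y = x * y" "\<one>\<^bsub>G\<^esub> = 1" for x y by (simp_all add: G_def)
  interpret G: factorial_monoid G unfolding G_def by (rule F.factorial_monoid_axioms)
  have unit: "u \<in> Units G \<longleftrightarrow> unit_in S u" for u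
    unfolding Units_def unit_in_def G by (auto simp: mult.commute)
  \<comment> \<open>\<open>G\<close> omits 0, so the two notions are compared only for nonzero
    \<open>b\<close>; products with a zero factor are treated separately below.\<close>
  have divides: "a divides\<^bsub>G\<^esub> b \<longleftrightarrow> divides_in S a b" if "b \<noteq> 0" for a b
    unfolding factor_def divides_in_def G using that by auto
  have prime: "prime_in S p" if p: "Divisibility.irreducible G p" "p \<in> carrier G" for p
  proof -
    have *: "p \<in> S" "p \<noteq> 0" using p(2) G by auto
    have pr: "Divisibility.prime G p" using G.irreducible_prime p by blast
    have "divides_in S p a \<or> divides_in S p b" if ab: "a \<in> S" "b \<in> S" "divides_in S p (a * b)"
      for a b
    proof (cases "a = 0 \<or> b = 0")
      case True
      then show ?thesis using S.zero_mem by (auto simp: divides_in_def)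
    next
      case False
      then show ?thesis using pr ab divides unfolding Divisibility.prime_def G by auto
    qed
    moreover have "\<not> unit_in S p" using pr unit by (simp add: Divisibility.prime_def)
    ultimately show ?thesis using * by (simp add: prime_in_def)
  qed
  show ?thesis
  proof
    fix a assume a: "a \<in> S" "a \<noteq> 0"
    show "prime_product S a"
    proof (cases "a \<in> Units G")
      case True
      then show ?thesis using unit prime_product.unit by blast
    next
      case False
      moreover have "a \<in> carrier G" using a G by auto
      ultimately obtain fs where fs: "set fs \<subseteq> carrier G" "factors G fs a" using G.factors_exist
        by blast
      have "\<forall>x\<in>set ps. prime_in S x \<Longrightarrow> prime_product S (foldr (\<otimes>\<^bsub>G\<^esub>) ps \<one>\<^bsub>G\<^esub>)" for ps
        by (induction ps) (auto simp: G intro: prime_product.intros S.unit_in_one)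
      then show ?thesis using fs prime unfolding factors_def by blast
    qed
  qed
qed

section \<open>Transport of factoriality along an injective ring homomorphism\<close>

context
  fixes \<phi> :: "'a::idom \<Rightarrow> 'b::idom"
  assumes inj: "\<phi> x = \<phi> y \<longleftrightarrow> x = y"
    and hom: "\<phi> 1 = 1" "\<phi> (x - y) = \<phi> x - \<phi> y" "\<phi> (x * y) = \<phi> x * \<phi> y"
begin

lemma divides_in_image_iff: "divides_in (\<phi> ` S) (\<phi> a) (\<phi> b) \<longleftrightarrow> divides_in S a b"
  by (simp add: divides_in_def inj flip: hom(3))

lemma unit_in_image_iff: "unit_in (\<phi> ` S) (\<phi> a) \<longleftrightarrow> unit_in S a"
  by (simp add: unit_in_def inj image_iff flip: hom(1,3))

lemma sqfree_in_image_iff: "sqfree_in (\<phi> ` S) (\<phi> a) \<longleftrightarrow> sqfree_in S a"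
  by (simp add: sqfree_in_def divides_in_image_iff unit_in_image_iff flip: hom(3))

lemma prime_in_image:
  assumes "prime_in S a"
  shows "prime_in (\<phi> ` S) (\<phi> a)"
proof -
  have "\<phi> 0 = 0" using hom(2)[of 1 1] by simp
  then have "\<phi> a \<noteq> 0" using assms inj[of a 0] by (simp add: prime_in_def)
  then show ?thesis
    using assms by (simp add: prime_in_def divides_in_image_iff unit_in_image_iff flip: hom(3))
qed

lemma prime_product_image: "prime_product S a \<Longrightarrow> prime_product (\<phi> ` S) (\<phi> a)"
  by (induction rule: prime_product.induct)
     (simp_all add: hom(3) prime_product.intros prime_in_image unit_in_image_iff)

lemma ufd_subring_image:
  assumes "ufd_subring S"
  shows "ufd_subring (\<phi> ` S)"
proof -
  interpret ufd_subring S by fact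
  have "\<phi> 0 = 0" using hom(2)[of 1 1] by simp
  show ?thesis
  proof
    show "1 \<in> \<phi> ` S" using one_mem hom(1) by (metis imageI)
    show "a - b \<in> \<phi> ` S" if "a \<in> \<phi> ` S" "b \<in> \<phi> ` S" for a b
      using that diff_mem by (auto simp flip: hom(2))
    show "a * b \<in> \<phi> ` S" if "a \<in> \<phi> ` S" "b \<in> \<phi> ` S" for a b
      using that mult_mem by (auto simp flip: hom(3))
    show "prime_product (\<phi> ` S) a" if a: "a \<in> \<phi> ` S" "a \<noteq> 0" for a
    proof -
      obtain b where b: "b \<in> S" "a = \<phi> b" using a(1) by blast
      then have "b \<noteq> 0" using a(2) \<open>\<phi> 0 = 0\<close> by auto
      then show ?thesis unfolding b(2) using factorable[OF b(1)] prime_product_image by blast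
    qed
  qed
qed

end

section \<open>Evaluation at \<open>t0\<close> as a place of K(t)\<close>

lemma regular_at_Fract: "poly q t0 \<noteq> 0 \<Longrightarrow> regular_at t0 (Fraction_Field.Fract p q)"
  by (auto simp: regular_at_def)

lemma fract_eval_Fract:
  assumes "poly q t0 \<noteq> 0"
  shows "fract_eval t0 (Fraction_Field.Fract p q) = poly p t0 / poly q t0"
  unfolding fract_eval_def
proof (rule the_equality)
  show "\<exists>p' q'. poly q' t0 \<noteq> 0 \<and> Fraction_Field.Fract p q = Fraction_Field.Fract p' q' \<and>
    poly p t0 / poly q t0 = poly p' t0 / poly q' t0"
    using assms by blast
  fix v assume "\<exists>p' q'. poly q' t0 \<noteq> 0 \<and> Fraction_Field.Fract p q = Fraction_Field.Fract p' q' \<and>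
    v = poly p' t0 / poly q' t0"
  then obtain p' q' where *: "poly q' t0 \<noteq> 0"
    "Fraction_Field.Fract p q = Fraction_Field.Fract p' q'" "v = poly p' t0 / poly q' t0" by blast
  have "q \<noteq> 0" "q' \<noteq> 0" using assms *(1) by auto
  then have "p * q' = p' * q" using *(2) by (simp add: eq_fract)
  then have "poly p t0 * poly q' t0 = poly p' t0 * poly q t0" by (metis poly_mult)
  then show "v = poly p t0 / poly q t0" unfolding *(3) using assms *(1) by (simp add: frac_eq_eq)
qed

text \<open>Factors \<open>t - t0\<close> are cancelled, by induction on the degree of the
  denominator. Hence a fraction with a pole at \<open>t0\<close> has an inverse that vanishes
  there.\<close>

lemma Fract_no_common_root:
  fixes f :: "'k::field poly fract"
  shows "\<exists>p q. q \<noteq> 0 \<and> f = Fraction_Field.Fract p q \<and> (poly p t0 \<noteq> 0 \<or> poly q t0 \<noteq> 0)"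
proof -
  have "\<exists>p' q'. q' \<noteq> 0 \<and> Fraction_Field.Fract p q = Fraction_Field.Fract p' q' \<and>
    (poly p' t0 \<noteq> 0 \<or> poly q' t0 \<noteq> 0)"
    if "q \<noteq> 0" for p q :: "'k poly"
    using that
  proof (induction "Polynomial.degree q" arbitrary: p q rule: less_induct)
    case less
    show ?case
    proof (cases "poly p t0 = 0 \<and> poly q t0 = 0")
      case True
      then obtain p' q' where pq: "p = [:- t0, 1:] * p'" "q = [:- t0, 1:] * q'"
        by (metis dvdE poly_eq_0_iff_dvd)
      then have "q' \<noteq> 0" using less(2) by auto
      then have "Polynomial.degree q = Suc (Polynomial.degree q')" using pq(2)
        by (simp add: degree_mult_eq del: mult_pCons_left)
      moreover have "Fraction_Field.Fract p q = Fraction_Field.Fract p' q'"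
        using \<open>q' \<noteq> 0\<close> less(2) pq by (simp add: eq_fract del: mult_pCons_left)
      ultimately show ?thesis using less(1)[of q' p'] \<open>q' \<noteq> 0\<close> by simp
    qed (use less(2) in blast)
  qed
  then show ?thesis by (cases f) metis
qed

interpretation specialization: place "regular_at t0" "fract_eval t0" for t0 :: "'k::field"
proof
  have one: "(1::'k poly fract) = Fraction_Field.Fract 1 1" by (rule One_fract_def)
  show "regular_at t0 1" "fract_eval t0 1 = 1"
    unfolding one by (simp_all add: regular_at_Fract fract_eval_Fract)
  fix x y :: "'k poly fract"
  {
    assume "regular_at t0 x" "regular_at t0 y"
    then obtain a b c d where *: "poly b t0 \<noteq> 0" "x = Fraction_Field.Fract a b" "poly d t0 \<noteq> 0"
      "y = Fraction_Field.Fract c d"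
      unfolding regular_at_def by blast
    have nz: "b \<noteq> 0" "d \<noteq> 0" using * by auto
    have bd: "poly (b * d) t0 \<noteq> 0" using * by simp
    have diff: "x - y = Fraction_Field.Fract (a * d - c * b) (b * d)" unfolding * using nz by simp
    have mult: "x * y = Fraction_Field.Fract (a * c) (b * d)" unfolding * by simp
    show "regular_at t0 (x - y)" "regular_at t0 (x * y)"
      unfolding diff mult using regular_at_Fract[OF bd] by blast+
    show "fract_eval t0 (x - y) = fract_eval t0 x - fract_eval t0 y"
      unfolding diff fract_eval_Fract[OF bd] unfolding * using *
        by (simp add: fract_eval_Fract field_simps)
    show "fract_eval t0 (x * y) = fract_eval t0 x * fract_eval t0 y"
      unfolding mult fract_eval_Fract[OF bd] unfolding * using * by (simp add: fract_eval_Fract)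
  next
    assume x: "\<not> regular_at t0 x"
    obtain p q where pq: "q \<noteq> 0" "x = Fraction_Field.Fract p q" "poly p t0 \<noteq> 0 \<or> poly q t0 \<noteq> 0"
      using Fract_no_common_root by blast
    then have *: "poly q t0 = 0" "poly p t0 \<noteq> 0" using x regular_at_Fract by blast+
    have "inverse x = Fraction_Field.Fract q p" unfolding pq by simp
    then show "regular_at t0 (inverse x)" "fract_eval t0 (inverse x) = 0"
      using * by (simp_all add: regular_at_Fract fract_eval_Fract)
  }
qed

lemma specialization_eq_reduce: "specialization t0 = specialization.reduce t0"
proof
  show "specialization t0 P = specialization.reduce t0 P" for P
    by (cases P) simp_all
qed

lemma regular_at_to_fract: "regular_at t0 (to_fract p)"
  and fract_eval_to_fract: "fract_eval t0 (to_fract p) = poly p t0"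
  using regular_at_Fract[of 1 t0 p] fract_eval_Fract[of 1 t0 p] by (simp_all add: to_fract_def)

lemma discriminant_curve_of_roots:
  "discriminant (curve_of_roots a b c) = 16 * ((a - b) * (a - c) * (b - c))\<^sup>2"
  by (simp add: discriminant_def curve_of_roots_def Let_def power2_eq_square power3_eq_cube
    algebra_simps)

lemma generic_curve_of_roots:
  "generic_curve (curve_of_roots a b c) = curve_of_roots (to_fract a) (to_fract b) (to_fract c)"
  by (simp add: generic_curve_def curve_of_roots_def)

lemma special_curve_of_roots:
  "special_curve t0 (curve_of_roots a b c) = curve_of_roots (poly a t0) (poly b t0) (poly c t0)"
  by (simp add: special_curve_def curve_of_roots_def)

theorem theorem1p2:
  fixes R :: "'k::field_char_0 set"
    and e1 e2 e3 :: "'k poly"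
    and t0 :: 'k
  defines "E \<equiv> curve_of_roots e1 e2 e3"
  assumes K: "number_field TYPE('k)"
    and R_between: "ring_of_integers \<subseteq> R"
    and R_ufd: "factorial_domain (ring_on R)"
    and R_units: "finitely_generated_units (ring_on R)"
    and R_class_number_one: "class_number TYPE('k) = 1 \<longrightarrow> R = ring_of_integers"
    and e_in: "e1 \<in> polys_over R" "e2 \<in> polys_over R" "e3 \<in> polys_over R"
    and E_elliptic: "elliptic_curve (generic_curve E)"
    and E_nonconstant: "nonconstant_curve (generic_curve E)"
    and C: "\<And>h f. h \<in> polys_over R \<Longrightarrow> Polynomial.degree h > 0 \<Longrightarrow>
              squarefree_in (ring_on (polys_over R)) h \<Longrightarrow>
              f \<in> {(e1 - e2) * (e1 - e3), (e2 - e1) * (e2 - e3), (e3 - e1) * (e3 - e2)} \<Longrightarrow>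
              h divides\<^bsub>ring_on (polys_over R)\<^esub> f \<Longrightarrow>
              \<not> (\<exists>z. poly h t0 = z^2)"
  shows "elliptic_curve (special_curve t0 E) \<and>
         specialization t0 \<in> mon (curve_group (generic_curve E))
                                 (curve_group (special_curve t0 E))"
proof -
  interpret R: ufd_subring R using R_ufd by (rule ufd_subring_factorial_domain)
  interpret P: ufd_in_field R
  proof
    fix x :: 'k
    \<comment> \<open>\<open>K\<close> is the fraction field of \<open>R\<close>: some nonzero
      integer multiple of \<open>x\<close> is an algebraic integer, hence in
      \<open>R\<close>.\<close>
    obtain d :: int where d: "d \<noteq> 0" "algebraic_int (of_int d * x)"
      using algebraic_int_multiple number_field_algebraic[OF K] by blast
    then have "of_int d * x \<in> R" "of_int d \<in> R" using R_between by (auto simp: ring_of_integers_def)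
    then show "\<exists>a\<in>R. \<exists>b\<in>R. b \<noteq> 0 \<and> b * x = a"
      using d(1) by (intro bexI[of _ "of_int d * x"] bexI[of _ "of_int d"]) auto
  qed
  define A where "A = (to_fract :: 'k poly \<Rightarrow> _) ` polys_over R"
  have inj: "to_fract x = to_fract y \<longleftrightarrow> x = y" for x y :: "'k poly" by simp
  note hom = to_fract_1[where ?'a = "'k poly"] to_fract_diff[where ?'a =
    "'k poly"] to_fract_mult[where ?'a = "'k poly"]
  interpret A: ufd_subring A
    unfolding A_def by (rule ufd_subring_image[OF inj hom P.poly.ufd_subring_axioms])
  interpret D: descent "regular_at t0" "fract_eval t0" A "to_fract e1" "to_fract e2" "to_fract e3"
  proof
    show "\<exists>a\<in>A. \<exists>b\<in>A. b \<noteq> 0 \<and> x = a / b" for x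
    proof (cases x)
      case (Fract p q)
      obtain c d where c: "c \<in> R" "c \<noteq> 0" "smult c p \<in> polys_over R"
        and d: "d \<in> R" "d \<noteq> 0" "smult d q \<in> polys_over R"
        using P.clear_denominators by meson
      \<comment> \<open>Scaling numerator and denominator by the same \<open>c * d\<close> puts both
        into R[t].\<close>
      have "x = to_fract (smult d (smult c p)) / to_fract (smult c (smult d q))"
        using Fract c d by (simp add: eq_fract mult.commute flip: Fract_conv_to_fract)
      moreover have "to_fract (smult d (smult c p)) \<in> A" "to_fract (smult c (smult d q)) \<in> A"
        unfolding A_def using P.smult_mem c d by blast+
      moreover have "to_fract (smult c (smult d q)) \<noteq> 0" using Fract c d by simp
      ultimately show ?thesis by blast
    qed
    show "regular_at t0 a" if "a \<in> A" for a using that regular_at_to_fract by (auto simp: A_def)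
    show "u = v" if uv: "unit_in A u" "unit_in A v" "fract_eval t0 u = fract_eval t0 v" for u v
    proof -
      obtain p q where "u = to_fract p" "v = to_fract q" using uv A.unit_in_mem A_def by blast
      moreover from this obtain c d where "p = [:c:]" "q = [:d:]"
        using uv unfolding A_def by (auto simp: unit_in_image_iff[OF inj hom] P.unit_in_poly_iff)
      ultimately show ?thesis using uv(3) by (simp add: fract_eval_to_fract)
    qed
    show "to_fract e1 \<in> A" "to_fract e2 \<in> A" "to_fract e3 \<in> A" using e_in by (simp_all add: A_def)
    show "to_fract e1 \<noteq> to_fract e2" "to_fract e1 \<noteq> to_fract e3" "to_fract e2 \<noteq> to_fract e3"
      using E_elliptic unfolding E_def elliptic_curve_def generic_curve_of_roots
        discriminant_curve_of_roots by auto
    show "\<exists>w. h = w\<^sup>2"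
      if h: "h \<in> A" "sqfree_in A h" "divides_in A h f" "fract_eval t0 h = z\<^sup>2"
        and f: "f \<in> {(to_fract e1 - to_fract e2) * (to_fract e1 - to_fract e3),
          (to_fract e2 - to_fract e1) * (to_fract e2 - to_fract e3),
          (to_fract e3 - to_fract e1) * (to_fract e3 - to_fract e2)}" for h f z
    proof -
      obtain g where g: "g \<in> polys_over R" "h = to_fract g" using h(1) by (auto simp: A_def)
      obtain f' where f': "f = to_fract f'"
        "f' \<in> {(e1 - e2) * (e1 - e3), (e2 - e1) * (e2 - e3), (e3 - e1) * (e3 - e2)}"
        using f by (auto simp flip: to_fract_diff to_fract_mult)
      have "squarefree_in (ring_on (polys_over R)) g" "g divides\<^bsub>ring_on (polys_over R)\<^esub> f'"
        using h(2,3) unfolding A_def g f' squarefree_in_ring_on_iff divides_ring_on_iff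
          sqfree_in_image_iff[OF inj hom] divides_in_image_iff[OF inj hom] by auto
      moreover have "poly g t0 = z\<^sup>2" using h(4) g(2) by (simp add: fract_eval_to_fract)
      \<comment> \<open>By (C) only a constant \<open>g\<close> can have the square value
        \<open>z^2\<close>; being constant, it equals that value.\<close>
      ultimately have "Polynomial.degree g = 0" using C[OF g(1) _ _ f'(2)] by blast
      then obtain c where "g = [:c:]" by (metis degree_0_id)
      then have "h = (to_fract [:z:])\<^sup>2"
        using g(2) \<open>poly g t0 = z\<^sup>2\<close> by (simp add: power2_eq_square flip: to_fract_mult)
      then show ?thesis by blast
    qed
  qed
  have special: "special_curve t0 E =
    curve_of_roots (fract_eval t0 (to_fract e1)) (fract_eval t0 (to_fract e2)) (fract_eval t0
      (to_fract e3))"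
    by (simp add: E_def special_curve_of_roots fract_eval_to_fract)
  show ?thesis
    unfolding special using D.reduce_mon D.ev_e_distinct
    by (simp add: E_def generic_curve_of_roots specialization_eq_reduce elliptic_curve_def
      discriminant_curve_of_roots)
qed

end
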